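(* Let $K$ be a field and let $L_2^\sigma=(x_1x_2,x_1x_3,\ldots,x_1x_{11},x_2x_3,x_2x_4)$, a squarefree lex ideal in $S'=K[x_1,\ldots,x_{11}]$ generated by squarefree monomials of degree $2$. Then $\mathrm{sdepth}(L_2^\sigma)=6<\mathrm{hdepth}(L_2^\sigma)=7$.
   Context: Let $S=K[x_1,\ldots,x_n]$. A Stanley decomposition of a monomial ideal $I\subset S$ is a direct sum decomposition of $K$-vector spaces $\mathcal{D}: I=\bigoplus_{i=1}^m m_iK[Z_i]$ with $m_i\in I$ monomials and $Z_i\subset\{x_1,\ldots,x_n\}$; $\mathrm{sdepth}(\mathcal{D})=\min_i|Z_i|$, and $\mathrm{sdepth}(I)$ is the maximum of $\mathrm{sdepth}(\mathcal{D})$ over all Stanley decompositions of $I$. Now let $S$ be $\mathbb{Z}$-graded with $\deg(x_i)=1$. A Hilbert decomposition of a graded ideal $I$ is an isomorphism of graded $K$-vector spaces $\mathcal{H}: I\cong\bigoplus_{i=1}^m K[Z_i](-s_i)$ with $s_i\in\mathbb{Z}_{\geq 0}$ and $Z_i\subset\{x_1,\ldots,x_n\}$; $\mathrm{hdepth}(\mathcal{H})=\min_i|Z_i|$, and $\mathrm{hdepth}(I)$ is the maximum of $\mathrm{hdepth}(\mathcal{H})$ over all Hilbert decompositions of $I$. A squarefree lex ideal is a squarefree monomial ideal $I$ such that whenever $u\in I$ and $v$ are squarefree monomials of the same degree with $v>_{\mathrm{lex}}u$ (with $x_1>x_2>\cdots$), then $v\in I$. *)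

theory Defs
  imports "HOL-Library.Poly_Mapping" "HOL-Library.FuncSet" "HOL-Algebra.Ideal"
begin

text \<open>
  Exponent vectors are finitely supported maps \<^typ>\<open>nat \<Rightarrow>\<^sub>0 nat\<close>; polynomials over a field are
  finitely supported maps from exponent vectors to coefficients, multiplied by convolution.
  The variables are indexed by positive naturals: \<^term>\<open>polys Z\<close> is the polynomial ring in the
  variables with index in \<^term>\<open>Z\<close>, so that $K[x_1,\ldots,x_n]$ is \<^term>\<open>polys {1..n}\<close>.
  A set of variables is represented by its set of indices.
\<close>

type_synonym expo = "nat \<Rightarrow>\<^sub>0 nat"
type_synonym 'k mpoly = "(nat \<Rightarrow>\<^sub>0 nat) \<Rightarrow>\<^sub>0 'k"

definition mono_poly :: "expo \<Rightarrow> 'k::field mpoly" where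
  "mono_poly t = Poly_Mapping.single t 1"

definition xvar :: "nat \<Rightarrow> 'k::field mpoly" where
  "xvar i = mono_poly (Poly_Mapping.single i 1)"

definition scale :: "'k::field \<Rightarrow> 'k mpoly \<Rightarrow> 'k mpoly" where
  "scale c p = Poly_Mapping.single 0 c * p"

definition polys :: "nat set \<Rightarrow> 'k::field mpoly set" where
  "polys Z = {p. \<forall>t \<in> Poly_Mapping.keys p. Poly_Mapping.keys t \<subseteq> Z}"

definition poly_ring :: "nat \<Rightarrow> 'k::field mpoly ring" where
  "poly_ring n = \<lparr>carrier = polys {1..n}, mult = (*), one = 1, zero = 0, add = (+)\<rparr>"

definition deg :: "expo \<Rightarrow> nat" where
  "deg t = (\<Sum>i \<in> Poly_Mapping.keys t. Poly_Mapping.lookup t i)"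

definition homogeneous :: "int \<Rightarrow> 'k::field mpoly set" where
  "homogeneous d = {p. \<forall>t \<in> Poly_Mapping.keys p. int (deg t) = d}"


text \<open>
  Every element of \<^term>\<open>V\<close> is, in exactly one way, a sum of elements of the listed subspaces, and
  all such sums lie in \<^term>\<open>V\<close>.
\<close>
definition is_direct_sum :: "'v::comm_monoid_add set \<Rightarrow> 'v set list \<Rightarrow> bool" where
  "is_direct_sum V Us \<longleftrightarrow>
     bij_betw (\<lambda>f. \<Sum>i<length Us. f i) (\<Pi>\<^sub>E i \<in> {..<length Us}. Us ! i) V"

text \<open>A decomposition is given by the list of its pairs $(m_i, Z_i)$, respectively $(s_i, Z_i)$.\<close>

definition stanley_space :: "expo \<times> nat set \<Rightarrow> 'k::field mpoly set" where
  "stanley_space = (\<lambda>(t, Z). (\<lambda>p. mono_poly t * p) ` polys Z)"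

definition stanley_decomposition ::
    "nat \<Rightarrow> 'k::field mpoly set \<Rightarrow> (expo \<times> nat set) list \<Rightarrow> bool" where
  "stanley_decomposition n I D \<longleftrightarrow>
     (\<forall>(t, Z) \<in> set D. mono_poly t \<in> I \<and> Z \<subseteq> {1..n}) \<and>
     is_direct_sum I (map stanley_space D)"

text \<open>
  The external direct sum $\bigoplus_i K[Z_i](-s_i)$ consists of the tuples with $i$-th entry in
  $K[Z_i]$; its component of degree $d$ consists of those with $i$-th entry in $K[Z_i]_{d-s_i}$.
\<close>
definition shifted_sum :: "(nat \<times> nat set) list \<Rightarrow> (nat \<Rightarrow> 'k::field mpoly) set" where
  "shifted_sum D = (\<Pi>\<^sub>E i \<in> {..<length D}. polys (snd (D ! i)))"

definition shifted_sum_component ::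
    "(nat \<times> nat set) list \<Rightarrow> int \<Rightarrow> (nat \<Rightarrow> 'k::field mpoly) set" where
  "shifted_sum_component D d =
     (\<Pi>\<^sub>E i \<in> {..<length D}. polys (snd (D ! i)) \<inter> homogeneous (d - int (fst (D ! i))))"

definition graded_iso ::
    "'k::field mpoly set \<Rightarrow> (nat \<times> nat set) list \<Rightarrow> ('k mpoly \<Rightarrow> nat \<Rightarrow> 'k mpoly) \<Rightarrow> bool" where
  "graded_iso I D \<phi> \<longleftrightarrow>
     bij_betw \<phi> I (shifted_sum D) \<and>
     (\<forall>p \<in> I. \<forall>q \<in> I. \<forall>i < length D. \<phi> (p + q) i = \<phi> p i + \<phi> q i) \<and>
     (\<forall>c. \<forall>p \<in> I. \<forall>i < length D. \<phi> (scale c p) i = scale c (\<phi> p i)) \<and>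
     (\<forall>d. \<phi> ` (I \<inter> homogeneous d) = shifted_sum_component D d)"

definition hilbert_decomposition ::
    "nat \<Rightarrow> 'k::field mpoly set \<Rightarrow> (nat \<times> nat set) list \<Rightarrow> bool" where
  "hilbert_decomposition n I D \<longleftrightarrow>
     (\<forall>(s, Z) \<in> set D. Z \<subseteq> {1..n}) \<and> (\<exists>\<phi>. graded_iso I D \<phi>)"

text \<open>
  For a nonzero ideal every decomposition is a nonempty list, so the minimum is over a nonempty
  finite set and bounded by $n$. For the zero ideal the depths below are unspecified.
\<close>
definition decomposition_depth :: "('a \<times> nat set) list \<Rightarrow> nat" where
  "decomposition_depth D = Min ((\<lambda>(_, Z). card Z) ` set D)"

definition sdepth :: "nat \<Rightarrow> 'k::field mpoly set \<Rightarrow> nat" where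
  "sdepth n I = Max {decomposition_depth D | D. stanley_decomposition n I D}"

definition hdepth :: "nat \<Rightarrow> 'k::field mpoly set \<Rightarrow> nat" where
  "hdepth n I = Max {decomposition_depth D | D. hilbert_decomposition n I D}"


definition squarefree_expo :: "nat \<Rightarrow> expo \<Rightarrow> bool" where
  "squarefree_expo n t \<longleftrightarrow> Poly_Mapping.keys t \<subseteq> {1..n} \<and> (\<forall>i. Poly_Mapping.lookup t i \<le> 1)"

definition squarefree_monomial_ideal :: "nat \<Rightarrow> 'k::field mpoly set \<Rightarrow> bool" where
  "squarefree_monomial_ideal n I \<longleftrightarrow>
     (\<exists>G. (\<forall>t \<in> G. squarefree_expo n t) \<and> I = genideal (poly_ring n) (mono_poly ` G))"

text \<open>
  The order on exponent vectors is the library order of \<^theory>\<open>HOL-Library.Poly_Mapping\<close>: the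
  larger vector has the larger entry at the smallest index where the two differ. This is the
  lexicographic order with $x_1 > x_2 > \cdots$.
\<close>
definition squarefree_lex_ideal :: "nat \<Rightarrow> 'k::field mpoly set \<Rightarrow> bool" where
  "squarefree_lex_ideal n I \<longleftrightarrow>
     squarefree_monomial_ideal n I \<and>
     (\<forall>u v. squarefree_expo n u \<and> squarefree_expo n v \<and> deg u = deg v \<and>
            mono_poly u \<in> I \<and> u < v \<longrightarrow> mono_poly v \<in> I)"

end

theory Submission
  imports Defs "HOL-Library.Disjoint_Sets" "HOL.Vector_Spaces"
begin

text \<open>
  A Stanley decomposition amounts to a partition of the exponents of the ideal into cones, and a
  Hilbert decomposition to an equality of Hilbert functions. If all $|Z_i|$ were at least 7 in a
  Stanley decomposition, the ten generators $x_1x_j$ would be apexes of disjoint cones, each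
  containing at least six monomials $x_1x_jx_z$ with $z \geq 2$; but there are only 55 such
  monomials. Conversely, $x_1(x_2,\ldots,x_{11})$ reduces to the maximal ideal in nine variables,
  whose nonempty supports are partitioned into intervals with top of size at least 5 by a cyclically
  symmetric family. For the Hilbert depth, the ideal has dimension 12 in degree 2 and 84 in degree 3,
  whereas twelve summands with $|Z_i| \geq 8$ would need dimension 96 in degree 3.
\<close>

text \<open>The gap between the depths is one of position, not of size. Twelve summands with $|Z_i|
  = 7$, one per generator, fill degree 3 exactly: $12 * 7 = 84$. But only 65 of the 84 monomials of
  degree 3 are divisible by $x_1$, while the cones of the ten generators $x_1x_j$ would need 70 of
  these; a graded isomorphism may send their excess to the other 19. Removing the multiples of
  $x_1^2$, of which each such cone contains at most one in degree 3, leaves the comparison of 60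
  with 55.

  All subspaces in the two definitions are spanned by monomials, so \<open>supported\<close> turns
  both notions into combinatorics of exponents and the answer does not depend on the field. The
  cones of the constructed partitions are moreover determined by supports, so infinitely many
  exponents reduce to the $2^{11}$ subsets of the variables, which evaluation can exhaust. Hilbert
  functions in all degrees are likewise compared by finitely many numbers, the coefficients of a
  polynomial of degree 11 in $t/(1-t)$.\<close>

abbreviation keys where "keys \<equiv> Poly_Mapping.keys"
abbreviation lookup where "lookup \<equiv> Poly_Mapping.lookup"
abbreviation single where "single \<equiv> Poly_Mapping.single"

subsection \<open>Spaces spanned by monomials\<close>

text \<open>Coordinate subspaces. The index type is arbitrary because both exponents and pairs of a
  position and an exponent occur as indices.\<close>

definition supported :: "'a set \<Rightarrow> ('a \<Rightarrow>\<^sub>0 'k::zero) set" where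
  "supported M = {p. keys p \<subseteq> M}"

lemma supported_iff: "p \<in> supported M \<longleftrightarrow> (\<forall>t. t \<notin> M \<longrightarrow> lookup p t = 0)"
  by (auto simp: supported_def in_keys_iff)

lemma supported_add: "p \<in> supported M \<Longrightarrow> q \<in> supported M \<Longrightarrow> p + q \<in> supported M"
  for p q :: "'a \<Rightarrow>\<^sub>0 'k::monoid_add"
  by (simp add: supported_iff lookup_add)

lemma supported_single: "t \<in> M \<Longrightarrow> single t c \<in> supported M"
  by (auto simp: supported_def)

lemma mono_poly_in_supported [simp]: "(mono_poly t :: 'k::field mpoly) \<in> supported M \<longleftrightarrow> t \<in> M"
  by (auto simp: supported_def mono_poly_def)

lemma sum_single_keys:
  fixes p :: "'a \<Rightarrow>\<^sub>0 'k::comm_monoid_add"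
  assumes "finite A" "keys p \<subseteq> A"
  shows "(\<Sum>t\<in>A. single t (lookup p t)) = p"
proof (rule poly_mapping_eqI)
  fix s
  have "(\<Sum>t\<in>A. lookup (single t (lookup p t)) s) = (\<Sum>t\<in>A. if t = s then lookup p s else 0)"
    by (intro sum.cong) (auto simp: lookup_single when_def)
  also have "\<dots> = lookup p s"
    using assms by (auto simp: in_keys_iff)
  finally show "lookup (\<Sum>t\<in>A. single t (lookup p t)) s = lookup p s"
    by (simp add: lookup_sum)
qed

definition restr :: "'a set \<Rightarrow> ('a \<Rightarrow>\<^sub>0 'k::zero) \<Rightarrow> 'a \<Rightarrow>\<^sub>0 'k" where
  "restr A p = Abs_poly_mapping (\<lambda>t. lookup p t when t \<in> A)"

lemma lookup_restr: "lookup (restr A p) t = (lookup p t when t \<in> A)"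
proof -
  have "finite {t. (lookup p t when t \<in> A) \<noteq> 0}"
    by (rule finite_subset[OF _ finite_lookup[of p]]) auto
  thus ?thesis by (simp add: restr_def)
qed

text \<open>A monomial lying in two of the sets would have two representations, and a monomial of
  \<open>M\<close> in none of them would have no representation. Conversely, disjointness lets every
  coefficient of a sum be read off from a single entry.\<close>

lemma is_direct_sum_supported_iff:
  fixes A :: "'a set list" and M :: "'a set"
  shows "is_direct_sum (supported M :: ('a \<Rightarrow>\<^sub>0 'k::field) set) (map supported A) \<longleftrightarrow>
    M = (\<Union>i<length A. A ! i) \<and> disjoint_family_on ((!) A) {..<length A}"
    (is "?L \<longleftrightarrow> ?R")
proof -
  let ?n = "length A"
  let ?P = "\<Pi>\<^sub>E i \<in> {..<?n}. (supported (A ! i) :: ('a \<Rightarrow>\<^sub>0 'k) set)"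
  let ?S = "\<lambda>f::nat \<Rightarrow> 'a \<Rightarrow>\<^sub>0 'k. \<Sum>i<?n. f i"
  have PiE: "(\<Pi>\<^sub>E i \<in> {..<?n}. (map supported A ! i :: ('a \<Rightarrow>\<^sub>0 'k) set)) = ?P"
    by (rule PiE_cong) simp
  have L: "?L \<longleftrightarrow> bij_betw ?S ?P (supported M)"
    unfolding is_direct_sum_def length_map PiE ..
  \<comment> \<open>The tuple whose only nonzero entry is the monomial \<open>t\<close> at position
    \<open>i\<close>; its sum is that monomial, whatever \<open>i\<close> is.\<close>
  define e :: "nat \<Rightarrow> 'a \<Rightarrow> nat \<Rightarrow> 'a \<Rightarrow>\<^sub>0 'k"
    where "e i t = (\<lambda>j\<in>{..<?n}. if j = i then single t (1::'k) else 0)" for i t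
  have eP: "e i t \<in> ?P" if "i < ?n" "t \<in> A ! i" for i t
    using that by (auto simp: e_def supported_single) (simp add: supported_def)
  have eS: "?S (e i t) = single t 1" if "i < ?n" for i t
    using that by (simp add: e_def sum.delta)
  show ?thesis
  proof
    assume l: ?L
    hence bij: "bij_betw ?S ?P (supported M)" by (simp add: L)
    have sub: "A ! i \<subseteq> M" if "i < ?n" for i
    proof
      fix t assume "t \<in> A ! i"
      hence "?S (e i t) \<in> supported M"
        using eP that bij by (metis (no_types, lifting) bij_betwE)
      thus "t \<in> M" using eS[OF that] by (simp add: supported_def)
    qed
    have sup: "t \<in> (\<Union>i<?n. A ! i)" if "t \<in> M" for t
    proof -
      have "single t 1 \<in> ?S ` ?P"
        using bij supported_single[OF that] by (metis bij_betw_imp_surj_on)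
      then obtain f where f: "f \<in> ?P" "single t 1 = ?S f" by auto
      have "(\<Sum>i<?n. lookup (f i) t) \<noteq> 0"
        by (metis f(2) lookup_single_eq lookup_sum zero_neq_one)
      then obtain i where i: "i < ?n" "lookup (f i) t \<noteq> 0"
        by (meson lessThan_iff sum.neutral)
      hence "t \<in> A ! i" using f(1) by (force simp: PiE_iff supported_iff)
      thus ?thesis using i by auto
    qed
    have "i = j" if "i < ?n" "j < ?n" "t \<in> A ! i" "t \<in> A ! j" for i j t
    proof -
      have "e i t = e j t"
        using bij that eP eS by (metis (no_types, lifting) bij_betw_imp_inj_on inj_onD)
      hence "e i t i = e j t i" by simp
      hence "(single t 1 :: 'a \<Rightarrow>\<^sub>0 'k) = (if i = j then single t 1 else 0)"
        using that by (simp add: e_def)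
      thus ?thesis by (metis lookup_single_eq lookup_zero zero_neq_one)
    qed
    thus ?R using sub sup by (fastforce simp: disjoint_family_on_def)
  next
    assume r: ?R
    hence disj: "i = j" if "i < ?n" "j < ?n" "t \<in> A ! i" "t \<in> A ! j" for i j t
      using that by (fastforce simp: disjoint_family_on_def)
    have lk: "lookup (?S f) t = lookup (f i) t" if "f \<in> ?P" "i < ?n" "t \<in> A ! i" for f i t
    proof -
      have z: "lookup (f j) t = 0" if "j < ?n" "j \<noteq> i" for j
        using disj \<open>f \<in> ?P\<close> \<open>i < ?n\<close> \<open>t \<in> A ! i\<close> that by (force simp: PiE_iff supported_iff)
      have "(\<Sum>j<?n. lookup (f j) t) = (\<Sum>j<?n. if j = i then lookup (f i) t else 0)"
        by (rule sum.cong) (auto simp: z)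
      thus ?thesis using that(2) by (simp add: lookup_sum)
    qed
    have "inj_on ?S ?P"
    proof (rule inj_onI)
      fix f g assume f: "f \<in> ?P" and g: "g \<in> ?P" and eq: "?S f = ?S g"
      show "f = g"
      proof (rule PiE_ext[OF f g])
        fix i assume "i \<in> {..<?n}"
        show "f i = g i"
        proof (rule poly_mapping_eqI)
          fix t show "lookup (f i) t = lookup (g i) t"
          proof (cases "t \<in> A ! i")
            case True
            thus ?thesis using lk[OF f] lk[OF g] eq \<open>i \<in> _\<close> by (metis lessThan_iff)
          next
            case False
            have "f i \<in> supported (A ! i)" "g i \<in> supported (A ! i)"
              using f g \<open>i \<in> _\<close> by (auto simp: PiE_iff)
            thus ?thesis using False by (simp add: supported_iff)
          qed
        qed
      qed
    qed
    moreover have "?S f \<in> supported M" if "f \<in> ?P" for f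
      unfolding supported_iff
    proof (intro allI impI)
      fix t assume t: "t \<notin> M"
      have "lookup (f i) t = 0" if "i < ?n" for i
        using \<open>f \<in> ?P\<close> that t r by (fastforce simp: PiE_iff supported_iff)
      thus "lookup (?S f) t = 0" by (simp add: lookup_sum)
    qed
    moreover have "p \<in> ?S ` ?P" if p: "p \<in> supported M" for p
    proof
      let ?f = "\<lambda>i\<in>{..<?n}. restr (A ! i) p"
      show f: "?f \<in> ?P" by (auto simp: supported_iff lookup_restr)
      show "p = ?S ?f"
      proof (rule poly_mapping_eqI)
        fix t show "lookup p t = lookup (?S ?f) t"
        proof (cases "t \<in> M")
          case True
          then obtain i where i: "i < ?n" "t \<in> A ! i" using r by auto
          show ?thesis using lk[OF f i] i by (simp add: lookup_restr)
        next
          case False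
          hence "lookup (restr (A ! i) p) t = 0" if "i < ?n" for i
            using r that by (auto simp: lookup_restr)
          thus ?thesis using False p by (simp add: lookup_sum supported_iff)
        qed
      qed
    qed
    ultimately show ?L unfolding L bij_betw_def by blast
  qed
qed

definition cone :: "expo \<times> nat set \<Rightarrow> expo set" where
  "cone = (\<lambda>(t, Z). {t + u | u. keys u \<subseteq> Z})"

lemma stanley_space_eq: "(stanley_space c :: 'k::field mpoly set) = supported (cone c)"
proof (cases c)
  case (Pair t Z)
  have 1: "mono_poly t * p \<in> supported (cone c)" if "p \<in> polys Z" for p :: "'k mpoly"
    using that keys_mult[of "mono_poly t" p]
    by (fastforce simp: supported_def cone_def Pair polys_def mono_poly_def)
  have 2: "q \<in> (\<lambda>p. mono_poly t * p) ` polys Z" if "q \<in> supported (cone c)" for q :: "'k mpoly"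
  proof
    \<comment> \<open>Here \<open>s - t\<close> is truncated subtraction, which is exact because
      \<open>s\<close> lies in the cone.\<close>
    let ?p = "\<Sum>s\<in>keys q. single (s - t) (lookup q s)"
    have s: "t + (s - t) = s" "keys (s - t) \<subseteq> Z" if s: "s \<in> keys q" for s
    proof -
      obtain u where "s = t + u" "keys u \<subseteq> Z"
        using s \<open>q \<in> _\<close> by (auto simp: supported_def cone_def Pair)
      thus "t + (s - t) = s" "keys (s - t) \<subseteq> Z" by simp_all
    qed
    have "mono_poly t * ?p = (\<Sum>s\<in>keys q. single s (lookup q s))"
      using s by (auto simp: sum_distrib_left mono_poly_def mult_single intro!: sum.cong)
    thus "q = mono_poly t * ?p" using sum_single_keys[of "keys q" q] by simp
    show "?p \<in> polys Z"
      using s keys_sum[of "\<lambda>s. single (s - t) (lookup q s)" "keys q"]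
      by (force simp: polys_def split: if_splits)
  qed
  show ?thesis using 1 2 by (auto simp: stanley_space_def Pair)
qed

lemma stanley_decomposition_supported_iff:
  "stanley_decomposition n (supported M :: 'k::field mpoly set) D \<longleftrightarrow>
     (\<forall>(t, Z) \<in> set D. t \<in> M \<and> Z \<subseteq> {1..n}) \<and>
     M = (\<Union>i<length D. cone (D ! i)) \<and> disjoint_family_on (\<lambda>i. cone (D ! i)) {..<length D}"
proof -
  have "map stanley_space D = map (supported :: _ \<Rightarrow> 'k mpoly set) (map cone D)"
    by (simp add: stanley_space_eq)
  moreover have "disjoint_family_on ((!) (map cone D)) {..<length D} \<longleftrightarrow>
      disjoint_family_on (\<lambda>i. cone (D ! i)) {..<length D}"
    by (simp add: disjoint_family_on_def)
  ultimately show ?thesis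
    using is_direct_sum_supported_iff[where 'k='k, of M "map cone D"]
    by (simp add: stanley_decomposition_def cong: map_cong)
qed

section \<open>Ideals generated by monomials\<close>

lemma polys_eq: "polys Z = supported {t. keys t \<subseteq> Z}"
  by (auto simp: polys_def supported_def)

lemma ring_poly_ring: "ring (poly_ring n :: 'k::field mpoly ring)"
proof -
  have m: "p * q \<in> polys Z" if "p \<in> polys Z" "q \<in> polys Z" for p q :: "'k mpoly" and Z
  proof -
    have "keys t \<subseteq> Z" if t: "t \<in> keys (p * q)" for t
    proof -
      obtain a b where "t = a + b" "a \<in> keys p" "b \<in> keys q"
        using subsetD[OF keys_mult t] by blast
      thus ?thesis using \<open>p \<in> _\<close> \<open>q \<in> _\<close> keys_add[of a b] by (force simp: polys_def)
    qed
    thus ?thesis by (simp add: polys_def)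
  qed
  have 0: "(0 :: 'k mpoly) \<in> polys Z" "(1 :: 'k mpoly) \<in> polys Z" for Z
    by (auto simp: polys_def)
  have a: "p + q \<in> polys Z" if "p \<in> polys Z" "q \<in> polys Z" for p q :: "'k mpoly" and Z
    using that by (simp add: polys_eq supported_add)
  have u: "- p \<in> polys Z" if "p \<in> polys Z" for p :: "'k mpoly" and Z
    using that by (simp add: polys_eq supported_iff)
  show ?thesis
  proof (rule ringI)
    show "abelian_group (poly_ring n :: 'k mpoly ring)"
    proof (rule abelian_groupI)
      fix x :: "'k mpoly" assume "x \<in> carrier (poly_ring n)"
      thus "\<exists>y\<in>carrier (poly_ring n). y \<oplus>\<^bsub>poly_ring n\<^esub> x = \<zero>\<^bsub>poly_ring n\<^esub>"
        by (intro bexI[of _ "- x"]) (auto simp: poly_ring_def u)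
    qed (auto simp: poly_ring_def a 0 ac_simps)
    show "Group.monoid (poly_ring n :: 'k mpoly ring)"
      by (rule monoidI) (auto simp: poly_ring_def m 0 mult.assoc)
  qed (auto simp: poly_ring_def algebra_simps)
qed

text \<open>The exponents divisible by some generator are closed under adding further exponents,
  which makes their span an ideal. Conversely, each polynomial in the span is the finite sum of its
  terms, and each term is a generator times a term of the ring.\<close>

lemma genideal_monomials:
  fixes G :: "expo set"
  assumes G: "\<And>g. g \<in> G \<Longrightarrow> keys g \<subseteq> {1..n}"
  shows "genideal (poly_ring n) (mono_poly ` G) =
    (supported {g + u | g u. g \<in> G \<and> keys u \<subseteq> {1..n}} :: 'k::field mpoly set)"
    (is "_ = supported ?M")
proof
  have sub: "keys t \<subseteq> {1..n}" if "t \<in> ?M" for t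
  proof -
    from that obtain g u where "t = g + u" "g \<in> G" "keys u \<subseteq> {1..n}" by blast
    thus ?thesis using G[of g] keys_add[of g u] by auto
  qed
  have prod: "p * q \<in> supported ?M" if "p \<in> polys {1..n}" "q \<in> supported ?M" for p q :: "'k mpoly"
  proof -
    have "t \<in> ?M" if t: "t \<in> keys (p * q)" for t
    proof -
      obtain a b where ab: "t = a + b" "a \<in> keys p" "b \<in> keys q"
        using subsetD[OF keys_mult t] by blast
      then obtain g u where "b = g + u" "g \<in> G" "keys u \<subseteq> {1..n}"
        using \<open>q \<in> _\<close> by (auto simp: supported_def)
      moreover have "keys a \<subseteq> {1..n}" using ab \<open>p \<in> _\<close> by (auto simp: polys_def)
      moreover have "t = g + (a + u)" using ab calculation by (simp add: ac_simps)
      ultimately show ?thesis using keys_add[of a u] by blast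
    qed
    thus ?thesis by (auto simp: supported_def)
  qed
  have prod': "q * p \<in> supported ?M" if "p \<in> polys {1..n}" "q \<in> supported ?M" for p q :: "'k mpoly"
    using prod[OF that] by (simp only: mult.commute[of q p])
  have sub': "(supported ?M :: 'k mpoly set) \<subseteq> polys {1..n}"
    using sub unfolding polys_def supported_def by blast
  have "ideal (supported ?M :: 'k mpoly set) (poly_ring n)"
  proof (rule idealI[OF ring_poly_ring])
    show "subgroup (supported ?M :: 'k mpoly set) (add_monoid (poly_ring n))"
    proof (rule group.subgroupI)
      show "Group.group (add_monoid (poly_ring n :: 'k mpoly ring))"
        using ring_poly_ring ring.is_abelian_group abelian_group.a_group by blast
      show "(supported ?M :: 'k mpoly set) \<subseteq> carrier (add_monoid (poly_ring n))"
        using sub' by (simp add: poly_ring_def)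
      show "(supported ?M :: 'k mpoly set) \<noteq> {}"
        by (auto simp: supported_def intro: exI[of _ 0])
      fix a :: "'k mpoly" assume a: "a \<in> supported ?M"
      have "inv\<^bsub>add_monoid (poly_ring n)\<^esub> a = - a"
      proof (rule group.inv_equality)
        show "Group.group (add_monoid (poly_ring n :: 'k mpoly ring))"
          using ring_poly_ring ring.is_abelian_group abelian_group.a_group by blast
      qed (use a sub' in \<open>auto simp: poly_ring_def supported_iff\<close>)
      thus "inv\<^bsub>add_monoid (poly_ring n)\<^esub> a \<in> supported ?M"
        using a by (simp add: supported_iff)
    qed (auto simp: poly_ring_def supported_add)
  qed (use prod prod' in \<open>auto simp: poly_ring_def\<close>)
  moreover have "mono_poly ` G \<subseteq> (supported ?M :: 'k mpoly set)"
    by (force intro: exI[of _ 0])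
  ultimately show "genideal (poly_ring n) (mono_poly ` G) \<subseteq> (supported ?M :: 'k mpoly set)"
    by (auto simp: genideal_def)
  show "(supported ?M :: 'k mpoly set) \<subseteq> genideal (poly_ring n) (mono_poly ` G)"
    unfolding genideal_def
  proof (intro subsetI InterI)
    fix p and I :: "'k mpoly set" assume p: "p \<in> (supported ?M :: 'k mpoly set)"
      and "I \<in> {I. ideal I (poly_ring n) \<and> mono_poly ` G \<subseteq> I}"
    hence I: "ideal I (poly_ring n)" and GI: "mono_poly ` G \<subseteq> I" by auto
    have zero: "0 \<in> I" and add: "\<And>a b. a \<in> I \<Longrightarrow> b \<in> I \<Longrightarrow> a + b \<in> I"
      and mul: "\<And>a x. a \<in> I \<Longrightarrow> x \<in> polys {1..n} \<Longrightarrow> a * x \<in> I"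
      using additive_subgroup.zero_closed[OF ideal.axioms(1)[OF I]]
        additive_subgroup.a_closed[OF ideal.axioms(1)[OF I]] ideal.I_r_closed[OF I]
      by (auto simp: poly_ring_def)
    have single_in: "single t c \<in> I" if t: "t \<in> ?M" for t c
    proof -
      obtain g u where "t = g + u" "g \<in> G" "keys u \<subseteq> {1..n}" using t by blast
      moreover from this have "single t c = mono_poly g * single u c"
        by (simp add: mono_poly_def mult_single)
      moreover have "single u c \<in> polys {1..n}" using calculation by (simp add: polys_def)
      ultimately show ?thesis using mul GI by auto
    qed
    have "(\<Sum>t\<in>A. single t (lookup p t)) \<in> I" if "finite A" "A \<subseteq> keys p" for A
      using that
    proof (induction A)
      case (insert t A)
      moreover have "single t (lookup p t) \<in> I"
        using p insert.prems by (intro single_in) (auto simp: supported_def)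
      ultimately show ?case by (simp add: add)
    qed (simp add: zero)
    from this[of "keys p"] show "p \<in> I" using sum_single_keys[of "keys p" p] by simp
  qed
qed

subsection \<open>Interval partitions\<close>

text \<open>
  A word over $\{0, 1, 2\}$ encodes an interval of sets: the letter 1 at position $i$ forces
  $i$ into the set, 0 excludes it, and 2 leaves it free. Position $i$ stands for $x_{i+1}$.
\<close>

definition fits :: "nat list \<Rightarrow> nat set \<Rightarrow> bool" where
  "fits w S \<longleftrightarrow> (\<forall>i<length w. (w ! i = 1 \<longrightarrow> i \<in> S) \<and> (w ! i = 0 \<longrightarrow> i \<notin> S))"

text \<open>Branches on whether position 0 belongs to the set: a branch keeps the words whose first
  letter allows that choice, and every leaf requires exactly one survivor. This decides a statement
  about all subsets by evaluation.\<close>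

fun exact_cover :: "nat \<Rightarrow> nat list list \<Rightarrow> bool" where
  "exact_cover 0 ws \<longleftrightarrow> length ws = 1"
| "exact_cover (Suc n) ws \<longleftrightarrow>
     exact_cover n (map tl (filter (\<lambda>w. hd w \<noteq> 0) ws)) \<and>
     exact_cover n (map tl (filter (\<lambda>w. hd w \<noteq> 1) ws))"

lemma fits_Cons:
  "fits (a # w) S \<longleftrightarrow> (a = 1 \<longrightarrow> 0 \<in> S) \<and> (a = 0 \<longrightarrow> 0 \<notin> S) \<and> fits w {i. Suc i \<in> S}"
  by (auto simp: fits_def All_less_Suc2)

lemma exact_cover_unique:
  assumes "exact_cover n ws" "\<And>w. w \<in> set ws \<Longrightarrow> length w = n"
  shows "length (filter (\<lambda>w. fits w S) ws) = 1"
  using assms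
proof (induction n arbitrary: ws S)
  case 0
  then obtain w where "ws = [w]" by (auto simp: length_Suc_conv)
  with 0 show ?case by (simp add: fits_def)
next
  case (Suc n)
  \<comment> \<open>The one letter that disagrees with \<open>S\<close> at position 0.\<close>
  define a :: nat where "a = (if 0 \<in> S then 0 else 1)"
  let ?S = "{i. Suc i \<in> S}"
  have *: "fits w S \<longleftrightarrow> hd w \<noteq> a \<and> fits (tl w) ?S" if "w \<in> set ws" for w
    using Suc.prems(2)[OF that] by (cases w) (auto simp: fits_Cons a_def)
  have "filter (\<lambda>w. fits w S) ws = filter (\<lambda>w. fits (tl w) ?S) (filter (\<lambda>w. hd w \<noteq> a) ws)"
    by (auto simp: * intro!: filter_cong)
  hence "length (filter (\<lambda>w. fits w S) ws) =
      length (filter (\<lambda>w. fits w ?S) (map tl (filter (\<lambda>w. hd w \<noteq> a) ws)))"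
    by (simp add: filter_map o_def)
  also have "\<dots> = 1"
    using Suc.prems by (intro Suc.IH) (auto simp: a_def)
  finally show ?case .
qed

section \<open>Cones over squarefree monomials\<close>

definition support_expo :: "nat set \<Rightarrow> expo" where
  "support_expo A = Abs_poly_mapping (\<lambda>i. of_bool (i \<in> A))"

lemma lookup_support_expo: "finite A \<Longrightarrow> lookup (support_expo A) i = of_bool (i \<in> A)"
  by (simp add: support_expo_def)

lemma keys_support_expo [simp]: "finite A \<Longrightarrow> keys (support_expo A) = A"
  by (auto simp: in_keys_iff lookup_support_expo)

text \<open>An exponent is at least 1 on \<open>A\<close> exactly when its support contains
  \<open>A\<close>. Since \<open>Z\<close> contains \<open>A\<close>, exponents on \<open>A\<close>
  can grow freely, and the cone depends on supports only.\<close>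

lemma cone_support_expo:
  assumes "finite A" "A \<subseteq> Z"
  shows "cone (support_expo A, Z) = {t. A \<subseteq> keys t \<and> keys t \<subseteq> Z}"
proof (intro equalityI subsetI)
  fix t :: expo assume "t \<in> cone (support_expo A, Z)"
  then obtain u where u: "t = support_expo A + u" "keys u \<subseteq> Z" by (auto simp: cone_def)
  have "keys t = A \<union> keys u"
    using assms by (auto simp: u in_keys_iff lookup_add lookup_support_expo)
  thus "t \<in> {t. A \<subseteq> keys t \<and> keys t \<subseteq> Z}" using assms u by auto
next
  fix t :: expo assume t: "t \<in> {t. A \<subseteq> keys t \<and> keys t \<subseteq> Z}"
  have "t = support_expo A + (t - support_expo A)"
  proof (rule poly_mapping_eqI)
    fix i
    have "lookup t i \<ge> of_bool (i \<in> A)"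
      using t by (auto simp: Suc_le_eq in_keys_iff)
    thus "lookup t i = lookup (support_expo A + (t - support_expo A)) i"
      using assms by (simp add: lookup_add lookup_minus lookup_support_expo)
  qed
  moreover have "keys (t - support_expo A) \<subseteq> Z"
    using t by (fastforce simp: in_keys_iff lookup_minus)
  ultimately show "t \<in> cone (support_expo A, Z)" unfolding cone_def by blast
qed

definition word_ones :: "nat list \<Rightarrow> nat set" where
  "word_ones w = Suc ` {i. i < length w \<and> w ! i = 1}"

definition word_support :: "nat list \<Rightarrow> nat set" where
  "word_support w = Suc ` {i. i < length w \<and> w ! i \<noteq> 0}"

text \<open>Positions with letter 1 stay among the free variables, so that the cone consists of all
  monomials whose support lies in the interval, with arbitrary positive exponents.\<close>

definition word_cone :: "nat list \<Rightarrow> expo \<times> nat set" where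
  "word_cone w = (support_expo (word_ones w), word_support w)"

lemma word_ones_subset: "word_ones w \<subseteq> word_support w"
  by (auto simp: word_ones_def word_support_def)

lemma finite_word_ones [simp]: "finite (word_ones w)"
  and finite_word_support [simp]: "finite (word_support w)"
  by (auto simp: word_ones_def word_support_def)

lemma word_support_bound: "word_support w \<subseteq> {1..length w}"
  by (auto simp: word_support_def)

lemma card_word_support: "card (word_support w) = length (filter (\<lambda>a. a \<noteq> 0) w)"
  by (simp add: word_support_def card_image length_filter_conv_card)

lemma cone_word_cone:
  "cone (word_cone w) = {t. keys t \<subseteq> {1..length w} \<and> fits w {i. Suc i \<in> keys t}}"
proof -
  have "keys t \<subseteq> word_support w \<longleftrightarrow>
      keys t \<subseteq> {1..length w} \<and> (\<forall>i<length w. w ! i = 0 \<longrightarrow> Suc i \<notin> keys t)" for t :: expo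
  proof -
    have "keys t \<subseteq> word_support w" if "keys t \<subseteq> {1..length w}"
      "\<forall>i<length w. w ! i = 0 \<longrightarrow> Suc i \<notin> keys t"
    proof
      fix x assume x: "x \<in> keys t"
      hence "x = Suc (x - 1)" "x - 1 < length w" using that(1) by fastforce+
      thus "x \<in> word_support w" using that(2) x unfolding word_support_def by (metis (mono_tags, lifting) imageI mem_Collect_eq)
    qed
    thus ?thesis using word_support_bound[of w] by (auto simp: word_support_def)
  qed
  moreover have "word_ones w \<subseteq> keys t \<longleftrightarrow> (\<forall>i<length w. w ! i = 1 \<longrightarrow> Suc i \<in> keys t)" for t :: expo
    by (auto simp: word_ones_def)
  ultimately show ?thesis
    by (auto simp: word_cone_def cone_support_expo word_ones_subset fits_def)
qed

section \<open>Partitions of the supports in the ideal\<close>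

definition lex_support :: "nat set \<Rightarrow> bool" where
  "lex_support S \<longleftrightarrow> 1 \<in> S \<and> (\<exists>j\<in>{2..11}. j \<in> S) \<or> 2 \<in> S \<and> (3 \<in> S \<or> 4 \<in> S)"

definition lex_expos :: "expo set" where
  "lex_expos = {t. keys t \<subseteq> {1..11} \<and> lex_support (keys t)}"

text \<open>Tests the smallest set of the interval only: the supports in the ideal are closed
  upwards, so the whole interval follows.\<close>

fun inner_word :: "nat list \<Rightarrow> bool" where
  "inner_word (a # b # c # d # w) \<longleftrightarrow>
     a = 1 \<and> 1 \<in> set (b # c # d # w) \<or> b = 1 \<and> (c = 1 \<or> d = 1)"
| "inner_word _ \<longleftrightarrow> False"

text \<open>These words cover the supports of the squarefree monomials outside the ideal.\<close>

definition outer_words :: "nat list list" where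
  "outer_words = [1 # replicate 10 0, 0 # 0 # replicate 9 2, 0 # 1 # 0 # 0 # replicate 7 2]"

text \<open>Adjoining words for the complement turns a partition of the supports in the ideal into
  one of all $2^{11}$ subsets, which \<open>exact_cover\<close> can test. Inner words fit only
  supports in the ideal and outer words only the others, so exactness on the ideal is
  recovered.\<close>

definition lex_tiling :: "nat list list \<Rightarrow> bool" where
  "lex_tiling ws \<longleftrightarrow> list_all (\<lambda>w. length w = 11 \<and> inner_word w) ws \<and> exact_cover 11 (ws @ outer_words)"

lemma inner_word_fits:
  assumes "inner_word w" "length w = 11" "fits w {i. Suc i \<in> S}"
  shows "lex_support S"
proof -
  obtain a b c d v where w: "w = a # b # c # d # v" using assms(1) by (cases w rule: inner_word.cases) auto
  have f: "Suc i \<in> S" if "i < 11" "w ! i = 1" for i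
    using assms(2,3) that by (auto simp: fits_def)
  from assms(1) consider "a = 1" "1 \<in> set (b # c # d # v)" | "b = 1" "c = 1" | "b = 1" "d = 1"
    unfolding w by auto
  thus ?thesis
  proof cases
    case 1
    then obtain i where "i < length (b # c # d # v)" "(b # c # d # v) ! i = 1" by (metis in_set_conv_nth)
    hence "Suc i < 11" "w ! Suc i = 1" using assms(2) by (auto simp: w)
    hence "Suc (Suc i) \<in> S" "Suc (Suc i) \<in> {2..11}" using f by auto
    moreover have "1 \<in> S" using f[of 0] 1 by (simp add: w)
    ultimately show ?thesis unfolding lex_support_def by blast
  next
    case 2
    thus ?thesis using f[of 1] f[of 2] by (simp add: w lex_support_def eval_nat_numeral)
  next
    case 3
    thus ?thesis using f[of 1] f[of 3] by (simp add: w lex_support_def eval_nat_numeral)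
  qed
qed

lemma outer_word_fits:
  assumes "w \<in> set outer_words" "fits w {i. Suc i \<in> S}"
  shows "\<not> lex_support S"
proof -
  have eq: "{2..11::nat} = {2,3,4,5,6,7,8,9,10,11}" by auto presburger
  show ?thesis
    using assms unfolding outer_words_def lex_support_def eq
    by (auto simp: fits_Cons eval_nat_numeral)
qed

lemma lex_tiling_partition:
  assumes "lex_tiling ws"
  shows "lex_expos = (\<Union>i<length ws. cone (word_cone (ws ! i)))"
    and "disjoint_family_on (\<lambda>i. cone (word_cone (ws ! i))) {..<length ws}"
proof -
  have len: "length w = 11" "inner_word w" if "w \<in> set ws" for w
    using assms that by (auto simp: lex_tiling_def list_all_iff)
  have len': "length w = 11" if "w \<in> set outer_words" for w
    using that by (auto simp: outer_words_def)
  have one: "length (filter (\<lambda>w. fits w S) (ws @ outer_words)) = 1" for S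
    using assms len len' by (intro exact_cover_unique[of 11]) (auto simp: lex_tiling_def)
  have mem: "t \<in> cone (word_cone w) \<longleftrightarrow> keys t \<subseteq> {1..11} \<and> fits w {i. Suc i \<in> keys t}"
    if "w \<in> set ws" for t w
    using len[OF that] by (simp add: cone_word_cone)
  show "lex_expos = (\<Union>i<length ws. cone (word_cone (ws ! i)))"
  proof (intro equalityI subsetI)
    fix t assume t: "t \<in> lex_expos"
    let ?S = "{i. Suc i \<in> keys t}"
    have "filter (\<lambda>w. fits w ?S) (ws @ outer_words) \<noteq> []" using one[of ?S] by force
    moreover have "filter (\<lambda>w. fits w ?S) outer_words = []"
      using t outer_word_fits by (auto simp: filter_empty_conv lex_expos_def)
    ultimately obtain w where "w \<in> set ws" "fits w ?S" by (auto simp: filter_empty_conv)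
    moreover from this have "t \<in> cone (word_cone w)" using t by (simp add: mem lex_expos_def)
    ultimately show "t \<in> (\<Union>i<length ws. cone (word_cone (ws ! i)))" by (auto simp: in_set_conv_nth)
  next
    fix t assume "t \<in> (\<Union>i<length ws. cone (word_cone (ws ! i)))"
    then obtain w where "w \<in> set ws" "t \<in> cone (word_cone w)" by (metis UN_E lessThan_iff nth_mem)
    thus "t \<in> lex_expos" using mem len inner_word_fits[of w "keys t"] by (simp add: lex_expos_def)
  qed
  have "i = j" if "i < length ws" "j < length ws" "t \<in> cone (word_cone (ws ! i))"
    "t \<in> cone (word_cone (ws ! j))" for i j t
  proof -
    let ?S = "{i. Suc i \<in> keys t}"
    have "card {i. i < length ws \<and> fits (ws ! i) ?S} \<le> Suc 0"
      using one[of ?S] by (simp add: length_filter_conv_card)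
    moreover have "finite {i. i < length ws \<and> fits (ws ! i) ?S}" by simp
    ultimately have "\<forall>a\<in>{i. i < length ws \<and> fits (ws ! i) ?S}. \<forall>b\<in>{i. i < length ws \<and> fits (ws ! i) ?S}. a = b"
      by (simp only: card_le_Suc0_iff_eq)
    thus ?thesis using that mem by auto
  qed
  thus "disjoint_family_on (\<lambda>i. cone (word_cone (ws ! i))) {..<length ws}"
    by (auto simp: disjoint_family_on_def)
qed

text \<open>
  Found by a computer search among the partitions of the nonempty subsets of $\mathbb{Z}/9$ that are
  invariant under rotation; the two remaining words below have orbits of length 3 and 1.
\<close>

definition base_words :: "nat list list" where
  "base_words =
    [[1,2,2,2,2,0,0,0,0], [1,1,0,2,2,1,0,0,0], [1,2,1,2,2,1,0,0,2],
     [1,0,0,1,2,1,0,2,2], [1,0,1,1,1,2,1,2,2], [1,1,2,1,0,1,0,1,0]]"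

text \<open>The interval sizes add up to $9(16+4+16+8+8+2) + 3 * 8 + 1 = 511 = 2^9 - 1$, the number
  of nonempty subsets. Every word has at least five nonzero letters.\<close>

definition cyclic_words :: "nat list list" where
  "cyclic_words =
     concat (map (\<lambda>w. map (\<lambda>k. rotate k w) [0..<9]) base_words) @
     map (\<lambda>k. rotate k [1,0,2,1,0,2,1,0,2]) [0..<3] @ [replicate 9 1]"

text \<open>Two words treat the monomials without $x_1$, and a third takes all multiples of
  $x_1x_{11}$. What remains is $x_1$ times a nonconstant monomial in $x_1,...,x_{10}$ that involves
  some of $x_2,...,x_{10}$; there the leading 1 raises five nonzero letters to six.\<close>

definition stanley_words :: "nat list list" where
  "stanley_words =
     [0 # 1 # 1 # replicate 8 2, 0 # 1 # 0 # 1 # replicate 7 2, 1 # replicate 9 2 @ [1]] @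
     map (\<lambda>w. 1 # w @ [0]) cyclic_words"

text \<open>One word per generator: $x_2x_3$ and $x_2x_4$ collect the monomials without $x_1$, and a
  multiple of $x_1$ is filed under $x_1x_j$ with $j$ its largest index. Some tops are too small for
  the depth, but all apexes have degree 2, which gives a simple formula for the Hilbert
  function.\<close>

definition counting_words :: "nat list list" where
  "counting_words =
     [0 # 1 # 1 # replicate 8 2, 0 # 1 # 0 # 1 # replicate 7 2] @
     map (\<lambda>k. 1 # replicate k 2 @ 1 # replicate (9 - k) 0) [0..<10]"

lemma lex_tiling_counting_words: "lex_tiling counting_words"
  by code_simp

lemma lex_tiling_stanley_words: "lex_tiling stanley_words"
  by code_simp

lemma stanley_words_large: "list_all (\<lambda>w. 6 \<le> length (filter (\<lambda>a. a \<noteq> 0) w)) stanley_words"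
  by code_simp

subsection \<open>Hilbert decompositions and Hilbert functions\<close>

text \<open>Over an infinite field the spaces cannot be counted, so dimensions are compared: the
  images of the unit vectors of \<open>A\<close> and the unit vectors of \<open>B\<close> are both
  independent, and each family lies in the span of the other. The map is linear on
  \<open>supported A\<close> only and the index types are arbitrary, so linearity is stated on that
  set and scaling coefficientwise.\<close>

lemma card_supported_linear_bij:
  fixes f :: "('a \<Rightarrow>\<^sub>0 'k::field) \<Rightarrow> ('b \<Rightarrow>\<^sub>0 'k)"
  assumes A: "finite A" and B: "finite B" and bij: "bij_betw f (supported A) (supported B)"
    and add: "\<And>p q. p \<in> supported A \<Longrightarrow> q \<in> supported A \<Longrightarrow> f (p + q) = f p + f q"
    and smult: "\<And>c p y. p \<in> supported A \<Longrightarrow>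
      lookup (f (Poly_Mapping.map ((*) c) p)) y = c * lookup (f p) y"
  shows "card A = card B"
proof -
  have lookup_smult: "lookup (Poly_Mapping.map ((*) c) p) y = c * lookup p y"
    for c :: 'k and p :: "'c \<Rightarrow>\<^sub>0 'k" and y
    by (simp add: Poly_Mapping.map.rep_eq when_def)
  interpret vs: vector_space "\<lambda>c. Poly_Mapping.map ((*) c) :: ('b \<Rightarrow>\<^sub>0 'k) \<Rightarrow> _"
    by standard (auto intro!: poly_mapping_eqI simp: lookup_smult lookup_add algebra_simps)
  let ?sm = "\<lambda>c. Poly_Mapping.map ((*) c) :: ('b \<Rightarrow>\<^sub>0 'k) \<Rightarrow> _"
  have zero: "(0 :: 'a \<Rightarrow>\<^sub>0 'k) \<in> supported A" by (simp add: supported_iff)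
  have f0: "f 0 = 0" using add[OF zero zero] by simp
  have sing: "f (single t c) = ?sm c (f (single t 1))" if "t \<in> A" for t c
    using smult[OF supported_single[OF that, of 1], of c]
    by (intro poly_mapping_eqI) (simp add: lookup_smult)
  \<comment> \<open>The induction has to keep each partial sum in \<open>supported A\<close>, where
    \<open>f\<close> is additive.\<close>
  have expand: "f (\<Sum>t\<in>C. single t (g t)) = (\<Sum>t\<in>C. ?sm (g t) (f (single t 1)))"
    if "C \<subseteq> A" for g C
    using finite_subset[OF that A] that
  proof (induction C)
    case (insert t C)
    have "(\<Sum>t\<in>C. single t (g t)) \<in> supported A"
      using insert.prems by (auto simp: supported_iff lookup_sum lookup_single when_def intro!: sum.neutral)
    thus ?case using insert by (simp add: add supported_single flip: sing)
  qed (simp add: f0)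
  define X where "X = (\<lambda>t. f (single t 1)) ` A"
  define Y where "Y = (\<lambda>t. single t (1::'k)) ` B"
  have inj: "inj_on f (supported A)" using bij by (rule bij_betw_imp_inj_on)
  have injX: "inj_on (\<lambda>t. f (single t 1)) A"
  proof (rule inj_onI)
    fix s t assume "s \<in> A" "t \<in> A" "f (single s 1) = f (single t 1)"
    hence "single s (1::'k) = single t 1" using inj by (auto simp: inj_on_def supported_single)
    thus "s = t" by (metis lookup_single_eq lookup_single_not_eq zero_neq_one)
  qed
  have injY: "inj_on (\<lambda>t. single t (1::'k)) B"
    by (rule inj_onI) (metis lookup_single_eq lookup_single_not_eq zero_neq_one)
  have fin: "finite X" "finite Y" using A B by (auto simp: X_def Y_def)
  have card: "card X = card A" "card Y = card B"
    by (auto simp: X_def Y_def card_image injX injY)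
  have expY: "(\<Sum>t\<in>B. ?sm (g t) (single t 1)) = (\<Sum>t\<in>B. single t (g t))" for g
    by (intro sum.cong refl poly_mapping_eqI) (simp add: lookup_smult lookup_single when_def)
  have "vs.independent X"
  proof (rule vs.independent_if_scalars_zero[OF fin(1)])
    fix u v assume sum: "(\<Sum>x\<in>X. ?sm (u x) x) = 0" and v: "v \<in> X"
    let ?p = "\<Sum>t\<in>A. single t (u (f (single t 1)))"
    have p: "?p \<in> supported A"
      by (auto simp: supported_iff lookup_sum lookup_single when_def intro!: sum.neutral)
    have "f ?p = 0"
      using sum by (simp add: expand X_def sum.reindex[OF injX])
    hence "?p = 0" using inj p zero f0 by (metis inj_onD)
    moreover obtain s where s: "s \<in> A" "v = f (single s 1)" using v by (auto simp: X_def)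
    moreover have "lookup ?p s = u v"
      using A s by (simp add: lookup_sum lookup_single when_def)
    ultimately show "u v = 0" by simp
  qed
  moreover have "vs.independent Y"
  proof (rule vs.independent_if_scalars_zero[OF fin(2)])
    fix u v assume sum: "(\<Sum>x\<in>Y. ?sm (u x) x) = 0" and v: "v \<in> Y"
    then obtain s where s: "s \<in> B" "v = single s 1" by (auto simp: Y_def)
    have "(\<Sum>t\<in>B. single t (u (single t 1))) = 0"
      using sum by (simp add: Y_def sum.reindex[OF injY])
    hence "0 = lookup (\<Sum>t\<in>B. single t (u (single t 1))) s" by (simp only: lookup_zero)
    also have "\<dots> = u v" using B s(1) unfolding s(2) by (simp add: lookup_sum lookup_single when_def)
    finally show "u v = 0" by (rule sym)
  qed
  moreover have "X \<subseteq> vs.span Y"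
  proof
    fix q assume "q \<in> X"
    hence "q \<in> supported B" using bij by (auto simp: X_def supported_single bij_betw_def)
    hence "q = (\<Sum>t\<in>B. ?sm (lookup q t) (single t 1))"
      using sum_single_keys[OF B, of q] by (simp add: expY supported_def)
    also have "\<dots> \<in> vs.span Y"
      by (intro vs.span_sum vs.span_scale vs.span_base) (simp add: Y_def)
    finally show "q \<in> vs.span Y" .
  qed
  moreover have "Y \<subseteq> vs.span X"
  proof
    fix q assume "q \<in> Y"
    hence "q \<in> f ` supported A" using bij by (auto simp: Y_def supported_single bij_betw_def)
    then obtain p where p: "p \<in> supported A" "q = f p" by auto
    hence "q = f (\<Sum>t\<in>A. single t (lookup p t))"
      using sum_single_keys[OF A, of p] by (simp add: supported_def)
    also have "\<dots> = (\<Sum>t\<in>A. ?sm (lookup p t) (f (single t 1)))" by (simp add: expand)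
    also have "\<dots> \<in> vs.span X"
      by (intro vs.span_sum vs.span_scale vs.span_base) (simp add: X_def)
    finally show "q \<in> vs.span X" .
  qed
  ultimately show ?thesis
    using vs.independent_span_bound fin card by (metis le_antisym)
qed

section \<open>Monomial bases of external direct sums\<close>

definition tuple_expos :: "(nat \<times> nat set) list \<Rightarrow> (nat \<times> expo) set" where
  "tuple_expos D = (SIGMA i:{..<length D}. {u. keys u \<subseteq> snd (D ! i)})"

definition tuple_deg :: "(nat \<times> nat set) list \<Rightarrow> nat \<times> expo \<Rightarrow> nat" where
  "tuple_deg D = (\<lambda>(i, u). fst (D ! i) + deg u)"

text \<open>Identifies a tuple with one finitely supported map on pairs, so that the external direct
  sum again has the form \<open>supported\<close>, with basis \<open>tuple_expos\<close>. The guard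
  discards the \<open>undefined\<close> entries that extensional tuples have from position
  \<open>n\<close> on.\<close>

definition flatten :: "nat \<Rightarrow> (nat \<Rightarrow> 'a \<Rightarrow>\<^sub>0 'k::zero) \<Rightarrow> nat \<times> 'a \<Rightarrow>\<^sub>0 'k" where
  "flatten n g = Abs_poly_mapping (\<lambda>(i, u). lookup (g i) u when i < n)"

lemma lookup_flatten: "lookup (flatten n g) (i, u) = (lookup (g i) u when i < n)"
proof -
  have "finite {x. (case x of (i, u) \<Rightarrow> lookup (g i) u when i < n) \<noteq> 0}"
    by (rule finite_subset[of _ "SIGMA i:{..<n}. keys (g i)"]) (auto simp: in_keys_iff)
  thus ?thesis by (simp add: flatten_def)
qed

lemma bij_betw_flatten:
  "bij_betw (flatten n) (\<Pi>\<^sub>E i\<in>{..<n}. supported (X i)) (supported (SIGMA i:{..<n}. X i))"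
  (is "bij_betw _ ?P ?S")
proof (rule bij_betw_imageI)
  show "inj_on (flatten n) ?P"
  proof (rule inj_onI)
    fix g h assume g: "g \<in> ?P" and h: "h \<in> ?P" and eq: "flatten n g = flatten n h"
    show "g = h"
    proof (rule PiE_ext[OF g h])
      fix i assume "i \<in> {..<n}"
      thus "g i = h i"
        using arg_cong[OF eq, of "\<lambda>p. lookup p (i, _)"] by (intro poly_mapping_eqI) (simp add: lookup_flatten)
    qed
  qed
  show "flatten n ` ?P = ?S"
  proof (intro equalityI subsetI)
    fix p assume "p \<in> flatten n ` ?P"
    thus "p \<in> ?S" by (fastforce simp: supported_iff lookup_flatten when_def PiE_iff)
  next
    fix p assume p: "p \<in> ?S"
    define g where "g = (\<lambda>i\<in>{..<n}. Abs_poly_mapping (\<lambda>u. lookup p (i, u)))"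
    have lg: "lookup (g i) u = lookup p (i, u)" if "i < n" for i u
    proof -
      have "finite {u. lookup p (i, u) \<noteq> 0}"
        by (rule finite_subset[of _ "snd ` keys p"]) (force simp: in_keys_iff)+
      thus ?thesis using that by (simp add: g_def)
    qed
    have "g \<in> ?P"
      using p lg by (auto simp: supported_iff PiE_iff g_def extensional_def)
    moreover have "flatten n g = p"
    proof (rule poly_mapping_eqI)
      fix x show "lookup (flatten n g) x = lookup p x"
        using p lg by (cases x) (auto simp: lookup_flatten supported_iff when_def)
    qed
    ultimately show "p \<in> flatten n ` ?P" by blast
  qed
qed

lemma homogeneous_eq: "homogeneous d = supported {t. int (deg t) = d}"
  by (auto simp: homogeneous_def supported_def)

lemma supported_Int: "supported A \<inter> supported B = supported (A \<inter> B)"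
  by (auto simp: supported_def)

lemma lookup_scale: "lookup (scale c p) t = c * lookup p t"
  by (simp add: scale_def flip: mult_map_scale_conv_mult) (simp add: Poly_Mapping.map.rep_eq when_def)

lemma scale_eq_map: "scale c p = Poly_Mapping.map ((*) c) p"
  by (simp add: scale_def mult_map_scale_conv_mult)

lemma shifted_sum_component_eq:
  "(shifted_sum_component D (int d) :: (nat \<Rightarrow> 'k::field mpoly) set) =
    (\<Pi>\<^sub>E i\<in>{..<length D}. supported {u. keys u \<subseteq> snd (D ! i) \<and> tuple_deg D (i, u) = d})"
  unfolding shifted_sum_component_def
  by (intro PiE_cong) (auto simp: polys_eq homogeneous_eq supported_Int tuple_deg_def intro!: arg_cong[of _ _ supported])

text \<open>A graded isomorphism restricts to each degree; after flattening, both sides are spanned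
  by finitely many basis elements, and the dimension is their number.\<close>

lemma hilbert_decomposition_card:
  fixes M :: "expo set"
  assumes "hilbert_decomposition n (supported M :: 'k::field mpoly set) D"
    and finM: "finite {t \<in> M. deg t = d}" and finD: "finite {x \<in> tuple_expos D. tuple_deg D x = d}"
  shows "card {t \<in> M. deg t = d} = card {x \<in> tuple_expos D. tuple_deg D x = d}"
proof -
  let ?A = "{t \<in> M. deg t = d}" and ?B = "{x \<in> tuple_expos D. tuple_deg D x = d}"
  obtain \<phi> :: "'k mpoly \<Rightarrow> nat \<Rightarrow> 'k mpoly" where "graded_iso (supported M) D \<phi>"
    using assms by (auto simp: hilbert_decomposition_def)
  hence bij: "bij_betw \<phi> (supported M) (shifted_sum D)"
    and add: "\<And>p q i. p \<in> supported M \<Longrightarrow> q \<in> supported M \<Longrightarrow> i < length D \<Longrightarrow> \<phi> (p + q) i = \<phi> p i + \<phi> q i"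
    and scale: "\<And>c p i. p \<in> supported M \<Longrightarrow> i < length D \<Longrightarrow> \<phi> (scale c p) i = scale c (\<phi> p i)"
    and img: "\<phi> ` (supported M \<inter> homogeneous (int d)) = shifted_sum_component D (int d)"
    by (auto simp: graded_iso_def)
  have dom: "supported M \<inter> homogeneous (int d) = (supported ?A :: 'k mpoly set)"
    by (auto simp: homogeneous_eq supported_Int intro!: arg_cong[of _ _ supported])
  have B: "?B = (SIGMA i:{..<length D}. {u. keys u \<subseteq> snd (D ! i) \<and> tuple_deg D (i, u) = d})"
    by (auto simp: tuple_expos_def)
  have sub: "supported ?A \<subseteq> (supported M :: 'k mpoly set)" by (auto simp: supported_def)
  have "bij_betw \<phi> (supported ?A) (shifted_sum_component D (int d))"
    using bij_betw_subset[OF bij sub] img dom by simp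
  hence "bij_betw (flatten (length D) \<circ> \<phi>) (supported ?A) (supported ?B)"
    unfolding shifted_sum_component_eq B by (rule bij_betw_trans[OF _ bij_betw_flatten])
  thus ?thesis
  proof (rule card_supported_linear_bij[OF finM finD])
    fix p q :: "'k mpoly" assume "p \<in> supported ?A" "q \<in> supported ?A"
    hence "p \<in> supported M" "q \<in> supported M" using sub by auto
    thus "(flatten (length D) \<circ> \<phi>) (p + q) = (flatten (length D) \<circ> \<phi>) p + (flatten (length D) \<circ> \<phi>) q"
      by (intro poly_mapping_eqI) (auto simp: lookup_flatten lookup_add add when_def split: prod.splits)
  next
    fix c and p :: "'k mpoly" and y assume "p \<in> supported ?A"
    hence "p \<in> supported M" using sub by auto
    thus "lookup ((flatten (length D) \<circ> \<phi>) (Poly_Mapping.map ((*) c) p)) y = c * lookup ((flatten (length D) \<circ> \<phi>) p) y"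
      by (cases y) (simp add: lookup_flatten scale lookup_scale when_def flip: scale_eq_map)
  qed
qed

text \<open>A degree-preserving bijection between the monomial bases extends linearly to a graded
  isomorphism.\<close>

lemma hilbert_decompositionI_bij:
  fixes M :: "expo set"
  assumes Z: "\<And>s Z. (s, Z) \<in> set D \<Longrightarrow> Z \<subseteq> {1..n}"
    and g: "bij_betw \<gamma> (tuple_expos D) M"
    and deg: "\<And>x. x \<in> tuple_expos D \<Longrightarrow> deg (\<gamma> x) = tuple_deg D x"
  shows "hilbert_decomposition n (supported M :: 'k::field mpoly set) D"
proof -
  let ?E = "tuple_expos D" and ?n = "length D"
  \<comment> \<open>Coefficients are pulled back along \<open>\<gamma>\<close>; its injectivity
    keeps the pulled-back support finite.\<close>
  define \<phi> :: "'k mpoly \<Rightarrow> nat \<Rightarrow> 'k mpoly" where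
    "\<phi> p = (\<lambda>i\<in>{..<?n}. Abs_poly_mapping (\<lambda>u. lookup p (\<gamma> (i, u)) when (i, u) \<in> ?E))" for p
  have l: "lookup (\<phi> p i) u = (lookup p (\<gamma> (i, u)) when (i, u) \<in> ?E)" if "i < ?n" for p i u
  proof -
    have "inj_on (\<lambda>u. \<gamma> (i, u)) {u. (i, u) \<in> ?E}"
      using bij_betw_imp_inj_on[OF g] by (auto simp: inj_on_def)
    hence "finite ((\<lambda>u. \<gamma> (i, u)) -` keys p \<inter> {u. (i, u) \<in> ?E})"
      by (intro finite_vimage_IntI) auto
    hence "finite {u. (lookup p (\<gamma> (i, u)) when (i, u) \<in> ?E) \<noteq> 0}"
      by (rule finite_subset[rotated]) (auto simp: in_keys_iff)
    thus ?thesis using that by (simp add: \<phi>_def)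
  qed
  have E: "(i, u) \<in> ?E \<longleftrightarrow> i < ?n \<and> keys u \<subseteq> snd (D ! i)" for i u
    by (auto simp: tuple_expos_def)
  have inM: "\<gamma> x \<in> M" if "x \<in> ?E" for x using g that by (rule bij_betwE[rule_format])
  have \<phi>_in: "\<phi> p \<in> shifted_sum D" for p
    by (auto simp: shifted_sum_def PiE_iff polys_eq supported_iff l E) (simp add: \<phi>_def)
  have "inj_on \<phi> (supported M)"
  proof (rule inj_onI, rule poly_mapping_eqI)
    fix p q t assume p: "p \<in> supported M" and q: "q \<in> supported M" and eq: "\<phi> p = \<phi> q"
    show "lookup p t = lookup q t"
    proof (cases "t \<in> M")
      case True
      then obtain i u where "t = \<gamma> (i, u)" "(i, u) \<in> ?E"
        using g by (metis bij_betw_imp_surj_on imageE surj_pair)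
      thus ?thesis using l[of i p u] l[of i q u] eq by (simp add: E)
    qed (use p q in \<open>simp add: supported_iff\<close>)
  qed
  moreover have "h \<in> \<phi> ` supported M" if h: "h \<in> shifted_sum D" for h
  proof
    let ?i = "inv_into ?E \<gamma>"
    \<comment> \<open>The preimage of \<open>h\<close>: its coefficient at \<open>t\<close> is the
      one that \<open>h\<close> has at the pair corresponding to \<open>t\<close>.\<close>
    define f where "f t = (lookup (h (fst (?i t))) (snd (?i t)) when t \<in> M)" for t
    have "finite {t. f t \<noteq> 0}"
    proof (rule finite_subset)
      show "{t. f t \<noteq> 0} \<subseteq> \<gamma> ` (SIGMA i:{..<?n}. keys (h i))"
      proof
        fix t assume "t \<in> {t. f t \<noteq> 0}"
        hence t: "t \<in> M" "lookup (h (fst (?i t))) (snd (?i t)) \<noteq> 0" by (auto simp: f_def)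
        have "t = \<gamma> (?i t)" "?i t \<in> ?E"
          using g t(1) by (simp_all add: bij_betw_def f_inv_into_f inv_into_into)
        moreover from this(2) have "fst (?i t) < ?n" by (auto simp: tuple_expos_def)
        moreover from this t(2) have "?i t \<in> (SIGMA i:{..<?n}. keys (h i))"
          by (cases "?i t") (simp add: in_keys_iff)
        ultimately show "t \<in> \<gamma> ` (SIGMA i:{..<?n}. keys (h i))" by (metis imageI)
      qed
    qed auto
    hence lf: "lookup (Abs_poly_mapping f) = f" by simp
    show "Abs_poly_mapping f \<in> supported M" by (simp add: supported_iff lf f_def)
    show "h = \<phi> (Abs_poly_mapping f)"
    proof (rule PiE_ext)
      show "h \<in> (\<Pi>\<^sub>E i\<in>{..<?n}. polys (snd (D ! i)))" using h by (simp add: shifted_sum_def)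
      show "\<phi> (Abs_poly_mapping f) \<in> (\<Pi>\<^sub>E i\<in>{..<?n}. polys (snd (D ! i)))"
        using \<phi>_in by (simp add: shifted_sum_def)
      fix i assume i: "i \<in> {..<?n}"
      show "h i = \<phi> (Abs_poly_mapping f) i"
      proof (rule poly_mapping_eqI)
        fix u
        have "lookup (h i) u = (f (\<gamma> (i, u)) when (i, u) \<in> ?E)"
        proof (cases "(i, u) \<in> ?E")
          case True
          thus ?thesis using g inM[OF True] by (simp add: f_def bij_betw_def)
        next
          case False
          hence "u \<notin> {u. keys u \<subseteq> snd (D ! i)}" using i by (simp add: E)
          moreover have "h i \<in> supported {u. keys u \<subseteq> snd (D ! i)}"
            using h i by (auto simp: shifted_sum_def polys_eq)
          ultimately show ?thesis using False by (simp add: supported_iff)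
        qed
        thus "lookup (h i) u = lookup (\<phi> (Abs_poly_mapping f) i) u"
          using i by (simp add: l lf)
      qed
    qed
  qed
  ultimately have bij: "bij_betw \<phi> (supported M) (shifted_sum D)"
    using \<phi>_in by (auto simp: bij_betw_def)
  \<comment> \<open>Both sides say that no basis element of another degree has a nonzero
    coefficient. Together with surjectivity this gives the image of every graded component.\<close>
  have comp: "\<phi> p \<in> shifted_sum_component D d \<longleftrightarrow> p \<in> homogeneous d" if p: "p \<in> supported M" for p d
  proof -
    have hom: "\<phi> p i \<in> homogeneous e \<longleftrightarrow>
        (\<forall>u. (i, u) \<in> ?E \<longrightarrow> lookup p (\<gamma> (i, u)) \<noteq> 0 \<longrightarrow> int (deg u) = e)" if "i < ?n" for i e
      using that by (auto simp: homogeneous_eq supported_iff l when_def)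
    have "\<phi> p \<in> shifted_sum_component D d \<longleftrightarrow> (\<forall>i<?n. \<phi> p i \<in> homogeneous (d - int (fst (D ! i))))"
      using \<phi>_in[of p] by (auto simp: shifted_sum_def shifted_sum_component_def PiE_iff)
    also have "\<dots> \<longleftrightarrow> (\<forall>x\<in>?E. lookup p (\<gamma> x) \<noteq> 0 \<longrightarrow> int (deg (\<gamma> x)) = d)"
      by (auto simp: hom E deg tuple_deg_def algebra_simps)
    also have "\<dots> \<longleftrightarrow> (\<forall>t\<in>M. lookup p t \<noteq> 0 \<longrightarrow> int (deg t) = d)"
      using bij_betw_imp_surj_on[OF g] by blast
    also have "\<dots> \<longleftrightarrow> p \<in> homogeneous d"
      using p by (auto simp: homogeneous_eq supported_iff)
    finally show ?thesis .
  qed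
  have sub: "shifted_sum_component D d \<subseteq> (shifted_sum D :: (nat \<Rightarrow> 'k mpoly) set)" for d
    by (auto simp: shifted_sum_def shifted_sum_component_def PiE_iff)
  have "\<phi> ` (supported M \<inter> homogeneous d) = shifted_sum_component D d" for d
  proof (intro equalityI subsetI)
    fix h assume h: "h \<in> (shifted_sum_component D d :: (nat \<Rightarrow> 'k mpoly) set)"
    then obtain p where "p \<in> supported M" "h = \<phi> p"
      using sub bij by (metis (no_types, lifting) bij_betw_imp_surj_on imageE subsetD)
    thus "h \<in> \<phi> ` (supported M \<inter> homogeneous d)" using h comp by blast
  qed (use comp in auto)
  hence "graded_iso (supported M) D \<phi>"
    unfolding graded_iso_def
    by (auto intro!: bij poly_mapping_eqI simp: l lookup_add lookup_scale when_def)
  thus ?thesis using Z by (auto simp: hilbert_decomposition_def)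
qed

text \<open>Equal finite counts give a bijection in each degree. These glue to one bijection because
  the degrees partition both bases.\<close>

lemma hilbert_decompositionI:
  fixes M :: "expo set"
  assumes Z: "\<And>s Z. (s, Z) \<in> set D \<Longrightarrow> Z \<subseteq> {1..n}"
    and finM: "\<And>d. finite {t \<in> M. deg t = d}"
    and finD: "\<And>d. finite {x \<in> tuple_expos D. tuple_deg D x = d}"
    and card: "\<And>d. card {t \<in> M. deg t = d} = card {x \<in> tuple_expos D. tuple_deg D x = d}"
  shows "hilbert_decomposition n (supported M :: 'k::field mpoly set) D"
proof -
  have "\<exists>h. bij_betw h {x \<in> tuple_expos D. tuple_deg D x = d} {t \<in> M. deg t = d}" for d
    using finM finD card by (intro finite_same_card_bij) auto
  then obtain h where h: "\<And>d. bij_betw (h d) {x \<in> tuple_expos D. tuple_deg D x = d} {t \<in> M. deg t = d}"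
    using choice[of "\<lambda>d h. bij_betw h {x \<in> tuple_expos D. tuple_deg D x = d} {t \<in> M. deg t = d}"] by blast
  define \<gamma> where "\<gamma> x = h (tuple_deg D x) x" for x
  have in_M: "\<gamma> x \<in> M" "deg (\<gamma> x) = tuple_deg D x" if "x \<in> tuple_expos D" for x
    using bij_betwE[OF h[of "tuple_deg D x"]] that unfolding \<gamma>_def by blast+
  have "bij_betw \<gamma> (tuple_expos D) M"
  proof (rule bij_betw_imageI)
    show "inj_on \<gamma> (tuple_expos D)"
    proof (rule inj_onI)
      fix x y assume xy: "x \<in> tuple_expos D" "y \<in> tuple_expos D" "\<gamma> x = \<gamma> y"
      hence eq: "tuple_deg D x = tuple_deg D y" using in_M by metis
      hence "h (tuple_deg D x) x = h (tuple_deg D x) y" using xy(3) by (simp add: \<gamma>_def)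
      thus "x = y" using xy(1,2) eq
        by (intro inj_onD[OF bij_betw_imp_inj_on[OF h[of "tuple_deg D x"]]]) simp_all
    qed
    have "t \<in> \<gamma> ` tuple_expos D" if "t \<in> M" for t
    proof -
      have "t \<in> h (deg t) ` {x \<in> tuple_expos D. tuple_deg D x = deg t}"
        using that by (simp add: bij_betw_imp_surj_on[OF h])
      then obtain x where x: "t = h (deg t) x" "x \<in> {x \<in> tuple_expos D. tuple_deg D x = deg t}"
        by (rule imageE)
      hence "\<gamma> x = t" unfolding \<gamma>_def by (simp flip: x(1))
      thus ?thesis using x(2) by blast
    qed
    thus "\<gamma> ` tuple_expos D = M" using in_M by auto
  qed
  thus ?thesis using Z in_M by (intro hilbert_decompositionI_bij) auto
qed

subsection \<open>Counting monomials\<close>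

lemma deg_eq: "finite A \<Longrightarrow> keys t \<subseteq> A \<Longrightarrow> deg t = (\<Sum>i\<in>A. lookup t i)"
  unfolding deg_def by (rule sum.mono_neutral_left) (auto simp: in_keys_iff)

lemma deg_add: "deg (t + u) = deg t + deg u"
proof -
  let ?A = "keys t \<union> keys u"
  have "deg (t + u) = (\<Sum>i\<in>?A. lookup (t + u) i)"
    by (rule deg_eq) (use keys_add[of t u] in auto)
  thus ?thesis by (simp add: deg_eq[of ?A] lookup_add sum.distrib)
qed

lemma deg_single [simp]: "deg (single i c) = c"
  by (simp add: deg_def)

lemma deg_eq_0_iff: "deg t = 0 \<longleftrightarrow> t = 0"
  by (auto simp: deg_def in_keys_iff intro!: poly_mapping_eqI)

lemma deg_support_expo: "finite A \<Longrightarrow> deg (support_expo A) = card A"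
  by (simp add: deg_def lookup_support_expo)

text \<open>The binomial coefficient $k+e-1$ over $e$, with value 1 at $k = e = 0$. The recursion
  separates the monomials divisible by the last variable from the others.\<close>

fun num_monomials :: "nat \<Rightarrow> nat \<Rightarrow> nat" where
  "num_monomials k 0 = 1"
| "num_monomials 0 (Suc e) = 0"
| "num_monomials (Suc k) (Suc e) = num_monomials k (Suc e) + num_monomials (Suc k) e"

lemma num_monomials_1 [simp]: "num_monomials k (Suc 0) = k"
  by (induction k) auto

text \<open>Monomials divisible by the new variable correspond to monomials of one degree less in
  the same variables, whence the inner induction on the degree.\<close>

lemma monomials_of_degree:
  assumes "finite Z"
  shows "finite {u. keys u \<subseteq> Z \<and> deg u = e} \<and>
    card {u. keys u \<subseteq> Z \<and> deg u = e} = num_monomials (card Z) e"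
  using assms
proof (induction Z arbitrary: e)
  case empty
  have "{u. keys u \<subseteq> {} \<and> deg u = e} = (if e = 0 then {0} else {})"
    by (auto simp: deg_eq_0_iff) (auto simp: deg_def)
  thus ?case by (cases e) auto
next
  case (insert z Z)
  show ?case
  proof (induction e)
    case 0
    have "{u. keys u \<subseteq> insert z Z \<and> deg u = 0} = {0}"
      by (auto simp: deg_eq_0_iff)
    thus ?case by simp
  next
    case (Suc e)
    let ?A = "{u. keys u \<subseteq> Z \<and> deg u = Suc e}"
    let ?B = "{u. keys u \<subseteq> insert z Z \<and> deg u = e}"
    let ?f = "\<lambda>u. u + single z (1::nat)"
    have inj: "inj_on ?f ?B" by (auto simp: inj_on_def)
    have "{u. keys u \<subseteq> insert z Z \<and> deg u = Suc e} = ?A \<union> ?f ` ?B"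
    proof (intro equalityI subsetI)
      fix u assume u: "u \<in> {u. keys u \<subseteq> insert z Z \<and> deg u = Suc e}"
      show "u \<in> ?A \<union> ?f ` ?B"
      proof (cases "z \<in> keys u")
        case True
        hence eq: "u = ?f (u - single z 1)"
          by (intro poly_mapping_eqI) (auto simp: lookup_add lookup_minus lookup_single when_def in_keys_iff)
        have "deg (u - single z 1) = e"
          using u arg_cong[OF eq, of deg] by (simp add: deg_add)
        moreover have "keys (u - single z 1) \<subseteq> keys u"
          by (auto simp: in_keys_iff lookup_minus)
        ultimately have "u - single z 1 \<in> ?B" using u by auto
        with eq show ?thesis by (intro UnI2) (rule image_eqI)
      qed (use u in auto)
    next
      fix u assume "u \<in> ?A \<union> ?f ` ?B"
      moreover have "keys (?f v) \<subseteq> insert z Z" if "keys v \<subseteq> insert z Z" for v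
        using keys_add[of v "single z 1"] that by auto
      ultimately show "u \<in> {u. keys u \<subseteq> insert z Z \<and> deg u = Suc e}"
        by (auto simp: deg_add)
    qed
    moreover have "?A \<inter> ?f ` ?B = {}"
      using insert.hyps by (auto simp: in_keys_iff lookup_add subset_iff)
    moreover have "card (?f ` ?B) = card ?B" by (rule card_image[OF inj])
    ultimately show ?case
      using insert Suc.IH by (simp add: card_Un_disjoint)
  qed
qed

section \<open>Hilbert functions of shifted polynomial rings\<close>

definition shifted_count :: "nat \<Rightarrow> nat \<Rightarrow> nat \<Rightarrow> nat" where
  "shifted_count s k d = (if s \<le> d then num_monomials k (d - s) else 0)"

text \<open>Multiplication by the last variable embeds $K[x_1,...,x_{k+1}](-s-1)$ into
  $K[x_1,...,x_{k+1}](-s)$ with quotient $K[x_1,...,x_k](-s)$.\<close>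

lemma shifted_count_rec:
  "shifted_count s (Suc k) d = shifted_count s k d + shifted_count (Suc s) (Suc k) d"
proof (cases "s < d")
  case True
  hence "d - s = Suc (d - Suc s)" by simp
  thus ?thesis using True by (simp add: shifted_count_def)
qed (auto simp: shifted_count_def)

lemma shifted_count_same [simp]: "shifted_count s k s = 1"
  by (simp add: shifted_count_def)

lemma card_shifted:
  assumes "finite Z"
  shows "finite {u. keys u \<subseteq> Z \<and> s + deg u = d}"
    "card {u. keys u \<subseteq> Z \<and> s + deg u = d} = shifted_count s (card Z) d"
proof -
  have "{u. keys u \<subseteq> Z \<and> s + deg u = d} = (if s \<le> d then {u. keys u \<subseteq> Z \<and> deg u = d - s} else {})"
    by auto
  thus "finite {u. keys u \<subseteq> Z \<and> s + deg u = d}"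
    "card {u. keys u \<subseteq> Z \<and> s + deg u = d} = shifted_count s (card Z) d"
    using monomials_of_degree[OF assms, of "d - s"] by (auto simp: shifted_count_def)
qed

lemma card_cone:
  assumes "finite Z"
  shows "finite {x \<in> cone (t, Z). deg x = d}"
    "card {x \<in> cone (t, Z). deg x = d} = shifted_count (deg t) (card Z) d"
proof -
  have eq: "{x \<in> cone (t, Z). deg x = d} = (\<lambda>u. t + u) ` {u. keys u \<subseteq> Z \<and> deg t + deg u = d}"
    by (auto simp: cone_def deg_add)
  show "finite {x \<in> cone (t, Z). deg x = d}"
    "card {x \<in> cone (t, Z). deg x = d} = shifted_count (deg t) (card Z) d"
    unfolding eq using card_shifted[OF assms, of "deg t" d] by (simp_all add: card_image)
qed

text \<open>Shift and number of variables of the cone of a word; its Hilbert function depends on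
  nothing else.\<close>

definition word_type :: "nat list \<Rightarrow> nat \<times> nat" where
  "word_type w = (length (filter (\<lambda>a. a = 1) w), length (filter (\<lambda>a. a \<noteq> 0) w))"

lemma sum_list_lessThan: "(\<Sum>i<length xs. f (xs ! i)) = sum_list (map f xs)"
  by (simp add: sum_list_sum_nth lessThan_atLeast0)

lemma lex_tiling_card:
  assumes "lex_tiling ws"
  shows "finite {t \<in> lex_expos. deg t = d}"
    "card {t \<in> lex_expos. deg t = d} = sum_list (map (\<lambda>(s, k). shifted_count s k d) (map word_type ws))"
proof -
  note part = lex_tiling_partition[OF assms]
  let ?C = "\<lambda>i. {t \<in> cone (word_cone (ws ! i)). deg t = d}"
  have eq: "{t \<in> lex_expos. deg t = d} = (\<Union>i<length ws. ?C i)"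
    using part(1) by auto
  have C: "finite (?C i)" "card (?C i) = (case word_type (ws ! i) of (s, k) \<Rightarrow> shifted_count s k d)" for i
  proof -
    have "deg (support_expo (word_ones w)) = length (filter (\<lambda>a. a = 1) w)" for w
      by (simp add: deg_support_expo word_ones_def card_image length_filter_conv_card)
    thus "finite (?C i)" "card (?C i) = (case word_type (ws ! i) of (s, k) \<Rightarrow> shifted_count s k d)"
      by (simp_all add: word_cone_def card_cone word_type_def card_word_support)
  qed
  show "finite {t \<in> lex_expos. deg t = d}" unfolding eq using C by simp
  have "card (\<Union>i<length ws. ?C i) = (\<Sum>i<length ws. card (?C i))"
    using part(2) C(1) by (intro card_UN_disjoint) (auto simp: disjoint_family_on_def)
  also have "\<dots> = sum_list (map (\<lambda>w. case word_type w of (s, k) \<Rightarrow> shifted_count s k d) ws)"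
    by (simp add: C sum_list_lessThan[where f = "\<lambda>w. case word_type w of (s, k) \<Rightarrow> shifted_count s k d"])
  finally show "card {t \<in> lex_expos. deg t = d} =
      sum_list (map (\<lambda>(s, k). shifted_count s k d) (map word_type ws))"
    by (simp add: eq o_def)
qed

lemma counting_words_type:
  "map word_type counting_words =
    [(2, 10), (2, 9), (2, 2), (2, 3), (2, 4), (2, 5), (2, 6), (2, 7), (2, 8), (2, 9), (2, 10), (2, 11)]"
  by code_simp

lemma card_lex_expos:
  "card {t \<in> lex_expos. deg t = d} =
     sum_list (map (\<lambda>k. shifted_count 2 k d) [10, 9, 2, 3, 4, 5, 6, 7, 8, 9, 10, 11])"
  by (simp only: lex_tiling_card(2)[OF lex_tiling_counting_words] counting_words_type) simp

lemma card_lex_expos_values: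
  "card {t \<in> lex_expos. deg t = 0} = 0" "card {t \<in> lex_expos. deg t = 1} = 0"
  "card {t \<in> lex_expos. deg t = 2} = 12" "card {t \<in> lex_expos. deg t = 3} = 84"
  unfolding card_lex_expos by code_simp+

text \<open>
  Splitting $K[x_1,\ldots,x_k](-s)$ by supports: there are $\binom{k-s}{i-s}$ squarefree monomials
  of degree $i$ divisible by a given one of degree $s$, each contributing $K[Z](-i)$ with $|Z| = i$.
\<close>

definition diagonal_coeff :: "nat \<Rightarrow> nat \<Rightarrow> nat \<Rightarrow> nat" where
  "diagonal_coeff s k i = (if s \<le> i then (k - s) choose (i - s) else 0)"

text \<open>With $y = t/(1-t)$ the Hilbert series $t^s/(1-t)^k$ equals $y^s(1+y)^{k-s}$, and the
  claim is its binomial expansion, as \<open>shifted_count i i\<close> has series $y^i$. The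
  induction is Pascal's rule: both terms of \<open>shifted_count_rec\<close> have a smaller
  difference $k-s$.\<close>

lemma shifted_count_diagonal:
  assumes "s \<le> k" "k \<le> N"
  shows "shifted_count s k d = (\<Sum>i\<le>N. diagonal_coeff s k i * shifted_count i i d)"
  using assms
proof (induction "k - s" arbitrary: s k)
  case 0
  hence "s = k" by simp
  have "(\<Sum>i\<le>N. diagonal_coeff k k i * shifted_count i i d) =
      (\<Sum>i\<le>N. if i = k then shifted_count k k d else 0)"
    by (intro sum.cong) (auto simp: diagonal_coeff_def binomial_eq_0)
  thus ?case using 0 \<open>s = k\<close> by simp
next
  case (Suc m)
  then obtain l where l: "k = Suc l" "s \<le> l" by (cases k) auto
  have coeff: "diagonal_coeff s (Suc l) i = diagonal_coeff s l i + diagonal_coeff (Suc s) (Suc l) i" for i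
  proof (cases "s < i")
    case True
    then obtain j where "i - s = Suc j" "i - Suc s = j" by (metis Suc_diff_Suc)
    thus ?thesis using True l by (simp add: diagonal_coeff_def Suc_diff_le)
  qed (auto simp: diagonal_coeff_def)
  have "shifted_count s l d = (\<Sum>i\<le>N. diagonal_coeff s l i * shifted_count i i d)"
    "shifted_count (Suc s) (Suc l) d = (\<Sum>i\<le>N. diagonal_coeff (Suc s) (Suc l) i * shifted_count i i d)"
    using Suc l by (intro Suc.hyps(1); simp)+
  thus ?case by (simp add: l shifted_count_rec[of s l] coeff sum.distrib algebra_simps)
qed

lemma sum_list_shifted_count:
  assumes "list_all (\<lambda>(c, s, k). s \<le> k \<and> k \<le> N) ps"
  shows "sum_list (map (\<lambda>(c, s, k). c * shifted_count s k d) ps) =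
    (\<Sum>i\<le>N. sum_list (map (\<lambda>(c, s, k). c * diagonal_coeff s k i) ps) * shifted_count i i d)"
  using assms
proof (induction ps)
  case (Cons p ps)
  obtain c s k where "p = (c, s, k)" by (cases p)
  thus ?case using Cons shifted_count_diagonal[of s k N d]
    by (simp add: sum.distrib sum_distrib_left algebra_simps)
qed simp

text \<open>A triple $(c, s, k)$ stands for $c$ copies of $K[x_1,\ldots,x_k](-s)$.\<close>

definition hilbert_blocks :: "(nat \<times> nat \<times> nat) list" where
  "hilbert_blocks = [(12, 2, 7), (49, 4, 7), (34, 5, 7), (82, 6, 7), (110, 7, 7), (155, 8, 8),
     (54, 9, 9), (11, 10, 10), (1, 11, 11)]"

text \<open>Both sides become polynomials in $y = t/(1-t)$, compared in their coefficients 0 to 11.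
  For the ideal these count the squarefree monomials by degree: 12, 60, 169, 301, 357, 287, 155, 54,
  11, 1 from degree 2 on. The blocks arise greedily: in each degree up to 7, whatever earlier blocks
  leave over opens summands with $k = 7$; from degree 8 on, $k$ is the degree itself. Nothing opens
  in degree 3, because $12 * 5 = 60$; in degree 4 there remain $169 - 120 = 49$.\<close>

lemma card_lex_expos_eq:
  "card {t \<in> lex_expos. deg t = d} =
     sum_list (map (\<lambda>(c, s, k). c * shifted_count s k d) hilbert_blocks)"
proof -
  let ?ps = "map (\<lambda>k. (1, 2, k)) [10, 9, 2, 3, 4, 5, 6, 7, 8, 9, 10, 11] :: (nat \<times> nat \<times> nat) list"
  let ?a = "\<lambda>ps i. sum_list (map (\<lambda>(c, s, k). c * diagonal_coeff s k i) ps)"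
  have "list_all (\<lambda>i. ?a ?ps i = ?a hilbert_blocks i) [0..<12]"
    by code_simp
  hence eq: "?a ?ps i = ?a hilbert_blocks i" if "i \<in> {..11}" for i
    using that unfolding list_all_iff by (fastforce simp only: set_upt atMost_iff atLeastLessThan_iff)
  have "card {t \<in> lex_expos. deg t = d} = sum_list (map (\<lambda>(c, s, k). c * shifted_count s k d) ?ps)"
    by (simp only: card_lex_expos) simp
  also have "\<dots> = (\<Sum>i\<le>11. ?a ?ps i * shifted_count i i d)"
    by (rule sum_list_shifted_count) simp
  also have "\<dots> = (\<Sum>i\<le>11. ?a hilbert_blocks i * shifted_count i i d)"
    using eq by (intro sum.cong) (simp_all only:)
  also have "\<dots> = sum_list (map (\<lambda>(c, s, k). c * shifted_count s k d) hilbert_blocks)"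
    by (rule sum_list_shifted_count[symmetric]) (simp add: hilbert_blocks_def)
  finally show ?thesis .
qed

subsection \<open>The two depths\<close>

text \<open>The third assumption bounds every depth by \<open>k\<close>, which makes the set finite
  and \<open>Max\<close> meaningful; it also excludes the empty list, whose minimum is
  unspecified.\<close>

lemma Max_depth_eq:
  fixes P :: "('a \<times> nat set) list \<Rightarrow> bool"
  assumes "P E" "\<And>t Z. (t, Z) \<in> set E \<Longrightarrow> k \<le> card Z"
    and "\<And>D. P D \<Longrightarrow> \<exists>(t, Z) \<in> set D. card Z \<le> k"
  shows "Max {decomposition_depth D | D. P D} = k"
proof (rule Max_eqI)
  have le: "decomposition_depth D \<le> k" if D: "P D" for D
  proof -
    obtain t Z where "(t, Z) \<in> set D" "card Z \<le> k" using assms(3)[OF D] by auto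
    moreover from this have "decomposition_depth D \<le> card Z"
      unfolding decomposition_depth_def by (intro Min_le) force+
    ultimately show ?thesis by simp
  qed
  show "finite {decomposition_depth D | D. P D}"
    by (rule finite_subset[of _ "{..k}"]) (auto dest: le)
  show "y \<le> k" if "y \<in> {decomposition_depth D | D. P D}" for y
    using that le by auto
  have "set E \<noteq> {}" using assms(3)[OF assms(1)] by auto
  hence "k \<le> decomposition_depth E"
    using assms(2) by (auto simp: decomposition_depth_def Min_ge_iff)
  hence "decomposition_depth E = k" using le[OF assms(1)] by simp
  thus "k \<in> {decomposition_depth D | D. P D}" using assms(1) by blast
qed

lemma sdepth_lex: "sdepth 11 (supported lex_expos :: 'k::field mpoly set) = 6"
  unfolding sdepth_def
proof (rule Max_depth_eq)
  let ?D = "map word_cone stanley_words"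
  note part = lex_tiling_partition[OF lex_tiling_stanley_words]
  have len: "length w = 11" "6 \<le> card (word_support w)" if "w \<in> set stanley_words" for w
    using lex_tiling_stanley_words stanley_words_large that
    by (auto simp: lex_tiling_def list_all_iff card_word_support)
  have nth: "cone (?D ! i) = cone (word_cone (stanley_words ! i))" if "i < length stanley_words" for i
    using that by simp
  have "t \<in> lex_expos \<and> Z \<subseteq> {1..11}" if tZ: "(t, Z) \<in> set ?D" for t Z
  proof -
    obtain w where w: "w \<in> set stanley_words" "(t, Z) = word_cone w" using tZ by auto
    hence "t \<in> cone (word_cone w)" by (auto simp: cone_def intro!: exI[of _ 0] dest: sym)
    hence "t \<in> lex_expos" using w(1) part(1) by (metis UN_I in_set_conv_nth lessThan_iff)
    thus ?thesis using w len word_support_bound[of w] by (auto simp: word_cone_def)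
  qed
  moreover have "lex_expos = (\<Union>i<length ?D. cone (?D ! i))"
    using part(1) nth by simp
  moreover have "disjoint_family_on (\<lambda>i. cone (?D ! i)) {..<length ?D}"
    using part(2) nth by (simp add: disjoint_family_on_def)
  ultimately show "stanley_decomposition 11 (supported lex_expos :: 'k mpoly set) ?D"
    unfolding stanley_decomposition_supported_iff by blast
  show "6 \<le> card Z" if "(t, Z) \<in> set ?D" for t Z
    using that len by (auto simp: word_cone_def)
next
  fix D assume "stanley_decomposition 11 (supported lex_expos :: 'k mpoly set) D"
  hence D: "\<And>t Z. (t, Z) \<in> set D \<Longrightarrow> t \<in> lex_expos \<and> Z \<subseteq> {1..11}"
    and part: "lex_expos = (\<Union>i<length D. cone (D ! i))"
    and disj: "disjoint_family_on (\<lambda>i. cone (D ! i)) {..<length D}"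
    unfolding stanley_decomposition_supported_iff by auto
  show "\<exists>(t, Z) \<in> set D. card Z \<le> 6"
  proof (rule ccontr)
    assume "\<not> (\<exists>(t, Z) \<in> set D. card Z \<le> 6)"
    hence large: "7 \<le> card Z" if "(t, Z) \<in> set D" for t Z using that by fastforce
    let ?J = "{2..11::nat}"
    let ?g = "\<lambda>j. single 1 1 + single j (1::nat) :: expo"
    have "\<exists>i<length D. \<exists>Z. D ! i = (?g j, Z)" if j: "j \<in> ?J" for j
    proof -
      have kg: "keys (?g j) = {1, j}" using j
        by (auto simp: in_keys_iff lookup_add lookup_single when_def split: if_splits)
      have "?g j \<in> lex_expos" unfolding lex_expos_def lex_support_def using j by (auto simp: kg simp del: One_nat_def)
      then obtain i where i: "i < length D" "?g j \<in> cone (D ! i)" using part by auto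
      obtain a Z where aZ: "D ! i = (a, Z)" by (cases "D ! i")
      then obtain u where u: "?g j = a + u" using i by (auto simp: cone_def)
      \<comment> \<open>The apex \<open>a\<close> lies in the ideal and divides $x_1x_j$, no proper
        divisor of which is in the ideal.\<close>
      have "a \<in> lex_expos" using D aZ i(1) by (metis nth_mem)
      moreover have "keys a \<subseteq> {1, j}"
      proof
        fix x assume "x \<in> keys a"
        hence "x \<in> keys (?g j)" unfolding u by (simp add: in_keys_iff lookup_add)
        thus "x \<in> {1, j}" by (simp only: kg)
      qed
      moreover have "1 \<in> S \<and> j \<in> S" if "lex_support S" "S \<subseteq> {1, j}" for S
        using that j unfolding lex_support_def by (cases "1 \<in> S"; cases "j \<in> S") fastforce+
      ultimately have ka: "1 \<in> keys a" "j \<in> keys a"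
        unfolding lex_expos_def by auto
      have "a = ?g j"
      proof (rule poly_mapping_eqI)
        fix x
        have "lookup (?g j) x = lookup a x + lookup u x" by (simp only: u lookup_add)
        moreover have "lookup (?g j) x \<le> 1 \<and> (x \<in> {1, j} \<longleftrightarrow> lookup (?g j) x = 1)"
          using j by (auto simp: lookup_add lookup_single when_def)
        moreover have "x \<in> {1, j} \<Longrightarrow> lookup a x \<noteq> 0"
          using ka by (auto simp: in_keys_iff)
        ultimately show "lookup a x = lookup (?g j) x" by (cases "x \<in> {1, j}") auto
      qed
      thus ?thesis using i aZ by auto
    qed
    then obtain I Z where IZ: "\<And>j. j \<in> ?J \<Longrightarrow> I j < length D \<and> D ! I j = (?g j, Z j)"
      by metis
    \<comment> \<open>Dropping the index 1 leaves out $x_1^2x_j$ and costs at most one of the seven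
      variables.\<close>
    define W where "W j = Z j \<inter> ?J" for j
    have "6 \<le> card (W j)" if "j \<in> ?J" for j
    proof -
      have mem: "(?g j, Z j) \<in> set D" using IZ[OF that] by (metis nth_mem)
      hence "Z j \<subseteq> insert 1 (W j)" using D by (fastforce simp: W_def)
      hence "card (Z j) \<le> card (insert 1 (W j))" by (intro card_mono) (auto simp: W_def)
      also have "\<dots> \<le> Suc (card (W j))" by (rule card_insert_le_m1) auto
      finally show ?thesis using large[OF mem] by simp
    qed
    hence "(\<Sum>j\<in>?J. 6) \<le> (\<Sum>j\<in>?J. card (W j))" by (rule sum_mono)
    also have "\<dots> = card (SIGMA j:?J. W j)" by (simp add: W_def)
    also have "\<dots> \<le> card (SIGMA a:?J. {a..11})"
    proof (rule card_inj_on_le)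
      \<comment> \<open>An unordered pair stands for the monomial $x_1x_jx_z$. Repetition is
        allowed, as \<open>Z j\<close> may contain \<open>j\<close>.\<close>
      let ?m = "\<lambda>(j, z). (min j z, max j z :: nat)"
      show "?m ` (SIGMA j:?J. W j) \<subseteq> (SIGMA a:?J. {a..11})" by (auto simp: W_def min_def max_def)
      have in_cone: "?g j + single z 1 \<in> cone (D ! I j)" if "j \<in> ?J" "z \<in> W j" for j z
      proof -
        have "keys (single z (1::nat)) \<subseteq> Z j" using that by (simp add: W_def)
        thus ?thesis using IZ[OF that(1)] unfolding cone_def by auto
      qed
      show "inj_on ?m (SIGMA j:?J. W j)"
      proof (rule inj_onI)
        fix x x' assume x: "x \<in> (SIGMA j:?J. W j)" "x' \<in> (SIGMA j:?J. W j)" and eq: "?m x = ?m x'"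
        obtain j z j' z' where xs: "x = (j, z)" "x' = (j', z')" by (cases x; cases x')
        hence j: "j \<in> ?J" "z \<in> W j" and j': "j' \<in> ?J" "z' \<in> W j'" using x by auto
        have or: "j = j' \<and> z = z' \<or> j = z' \<and> z = j'"
          using eq by (auto simp: xs min_def max_def split: if_splits)
        hence "?g j + single z 1 = ?g j' + single z' 1" by (auto simp: ac_simps)
        \<comment> \<open>A common monomial forces the two cones to be the same summand, hence to
          have the same apex.\<close>
        hence "I j = I j'"
          using in_cone[OF j] in_cone[OF j'] disj IZ[OF j(1)] IZ[OF j'(1)]
          by (fastforce simp: disjoint_family_on_def)
        hence "?g j = ?g j'" using IZ[OF j(1)] IZ[OF j'(1)] by simp
        hence "j = j'" by (metis add_left_cancel lookup_single_eq lookup_single_not_eq zero_neq_one)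
        thus "x = x'" using or by (auto simp: xs)
      qed
    qed simp
    \<comment> \<open>The number of pairs is $10 + 9 + ... + 1 = 55$, less than $10 * 6 =
      60$.\<close>
    also have "\<dots> = 55" by (simp add: numeral_eq_Suc)
    finally show False by simp
  qed
qed

lemma card_tuple_expos:
  assumes "\<And>s Z. (s, Z) \<in> set D \<Longrightarrow> finite Z"
  shows "finite {x \<in> tuple_expos D. tuple_deg D x = d}"
    "card {x \<in> tuple_expos D. tuple_deg D x = d} =
      sum_list (map (\<lambda>(s, Z). shifted_count s (card Z) d) D)"
proof -
  let ?U = "\<lambda>i. {u. keys u \<subseteq> snd (D ! i) \<and> fst (D ! i) + deg u = d}"
  have eq: "{x \<in> tuple_expos D. tuple_deg D x = d} = (SIGMA i:{..<length D}. ?U i)"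
    by (auto simp: tuple_expos_def tuple_deg_def)
  have fin: "finite (snd (D ! i))" if "i < length D" for i
    using assms[of "fst (D ! i)" "snd (D ! i)"] that by simp
  show "finite {x \<in> tuple_expos D. tuple_deg D x = d}"
    unfolding eq using card_shifted(1)[OF fin] by (intro finite_SigmaI) auto
  have "card (SIGMA i:{..<length D}. ?U i) = (\<Sum>i<length D. card (?U i))"
    using card_shifted(1)[OF fin] by (intro card_SigmaI) auto
  also have "\<dots> = (\<Sum>i<length D. shifted_count (fst (D ! i)) (card (snd (D ! i))) d)"
    by (intro sum.cong refl card_shifted(2) fin) simp
  also have "\<dots> = sum_list (map (\<lambda>(s, Z). shifted_count s (card Z) d) D)"
    using sum_list_lessThan[where f = "\<lambda>(s, Z). shifted_count s (card Z) d" and xs = D]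
    by (simp add: case_prod_unfold)
  finally show "card {x \<in> tuple_expos D. tuple_deg D x = d} =
      sum_list (map (\<lambda>(s, Z). shifted_count s (card Z) d) D)"
    by (simp add: eq)
qed

lemma hdepth_lex: "hdepth 11 (supported lex_expos :: 'k::field mpoly set) = 7"
  unfolding hdepth_def
proof (rule Max_depth_eq)
  \<comment> \<open>Only the size of \<open>Z\<close> enters the Hilbert function, so initial
    segments of the variables serve.\<close>
  let ?D = "concat (map (\<lambda>(c, s, k). replicate c (s, {1..k})) hilbert_blocks) :: (nat \<times> nat set) list"
  have D: "\<exists>k. Z = {1..k} \<and> 7 \<le> k \<and> k \<le> 11" if "(s, Z) \<in> set ?D" for s Z
    using that by (auto simp: hilbert_blocks_def)
  have fin: "finite Z" if "(s, Z) \<in> set ?D" for s Z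
    using D[OF that] by auto
  have blocks: "sum_list (map (\<lambda>(s, Z). shifted_count s (card Z) d)
      (concat (map (\<lambda>(c, s, k). replicate c (s, {1..k})) ps))) =
      sum_list (map (\<lambda>(c, s, k). c * shifted_count s k d) ps)" for d and ps :: "(nat \<times> nat \<times> nat) list"
    by (induction ps) (auto simp: sum_list_replicate)
  have card: "card {x \<in> tuple_expos ?D. tuple_deg ?D x = d} = card {t \<in> lex_expos. deg t = d}" for d
    by (simp only: card_tuple_expos(2)[OF fin] card_lex_expos_eq blocks)
  show "hilbert_decomposition 11 (supported lex_expos :: 'k mpoly set) ?D"
  proof (rule hilbert_decompositionI)
    show "Z \<subseteq> {1..11}" if "(s, Z) \<in> set ?D" for s Z using D[OF that] by auto
    show "finite {x \<in> tuple_expos ?D. tuple_deg ?D x = d}" for d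
      by (rule card_tuple_expos(1)[OF fin])
  qed (simp_all only: card lex_tiling_card(1)[OF lex_tiling_counting_words])
  show "7 \<le> card Z" if "(s, Z) \<in> set ?D" for s Z
    using D[OF that] by auto
next
  fix D assume D: "hilbert_decomposition 11 (supported lex_expos :: 'k mpoly set) D"
  have fin: "finite Z" if "(s, Z) \<in> set D" for s Z
  proof (rule finite_subset)
    show "Z \<subseteq> {1..11}" using D that by (fastforce simp: hilbert_decomposition_def)
  qed simp
  let ?h = "\<lambda>d. sum_list (map (\<lambda>(s, Z). shifted_count s (card Z) d) D)"
  have h: "card {t \<in> lex_expos. deg t = d} = ?h d" for d
    using hilbert_decomposition_card[OF D lex_tiling_card(1)[OF lex_tiling_counting_words]
        card_tuple_expos(1)[OF fin]] card_tuple_expos(2)[OF fin] by simp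
  show "\<exists>(s, Z) \<in> set D. card Z \<le> 7"
  proof (rule ccontr)
    assume "\<not> (\<exists>(s, Z) \<in> set D. card Z \<le> 7)"
    hence large: "8 \<le> card Z" if "(s, Z) \<in> set D" for s Z using that by fastforce
    \<comment> \<open>A summand of shift \<open>s\<close> contributes its constants in degree
      \<open>s\<close>, but the ideal is zero in degrees 0 and 1.\<close>
    have "2 \<le> s" if sZ: "(s, Z) \<in> set D" for s Z
    proof (rule ccontr)
      assume "\<not> 2 \<le> s"
      hence "s = 0 \<or> s = 1" by auto
      hence "?h s = 0" using h[of s] card_lex_expos_values by auto
      hence "shifted_count s (card Z) s = 0" using sZ by fastforce
      thus False by simp
    qed
    \<comment> \<open>A summand of shift 2 has dimension 1 in degree 2 and $|Z|$ in degree 3; larger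
      shifts contribute nothing in degree 2.\<close>
    hence "8 * shifted_count s (card Z) 2 \<le> shifted_count s (card Z) 3" if "(s, Z) \<in> set D" for s Z
      using that large[OF that] by (fastforce simp: shifted_count_def)
    hence "sum_list (map (\<lambda>(s, Z). 8 * shifted_count s (card Z) 2) D) \<le> ?h 3"
      by (intro sum_list_mono) auto
    hence "8 * ?h 2 \<le> ?h 3"
      by (simp add: sum_list_const_mult[symmetric] case_prod_unfold)
    thus False using h[of 2] h[of 3] card_lex_expos_values by simp
  qed
qed

section \<open>The generators and the squarefree lex property\<close>

lemma support_expo_pair: "i \<noteq> j \<Longrightarrow> support_expo {i, j} = single i 1 + single j 1"
  by (rule poly_mapping_eqI) (auto simp: lookup_support_expo lookup_add lookup_single when_def)

lemma mono_support_expo_pair: "i \<noteq> j \<Longrightarrow> mono_poly (support_expo {i, j}) = (xvar i * xvar j :: 'k::field mpoly)"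
  by (simp add: support_expo_pair mono_poly_def xvar_def mult_single)

definition lex_generators :: "nat set set" where
  "lex_generators = (\<lambda>j. {1, j}) ` {2..11} \<union> {{2, 3}, {2, 4}}"

lemma lex_generatorsD: "e \<in> lex_generators \<Longrightarrow> finite e \<and> e \<subseteq> {1..11}"
  by (auto simp: lex_generators_def)

lemma lex_support_iff: "lex_support S \<longleftrightarrow> (\<exists>e\<in>lex_generators. e \<subseteq> S)"
  by (auto simp: lex_support_def lex_generators_def)

text \<open>The multiples of a squarefree generator form a cone over all variables, so membership in
  the ideal becomes a condition on supports.\<close>

lemma genideal_lex:
  "genideal (poly_ring 11) (mono_poly ` support_expo ` lex_generators) =
    (supported lex_expos :: 'k::field mpoly set)"
proof -
  have "{g + u | g u. g \<in> support_expo ` lex_generators \<and> keys u \<subseteq> {1..11}} =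
      (\<Union>e\<in>lex_generators. cone (support_expo e, {1..11}))"
    by (auto simp: cone_def)
  also have "\<dots> = (\<Union>e\<in>lex_generators. {t. e \<subseteq> keys t \<and> keys t \<subseteq> {1..11}})"
    using lex_generatorsD by (simp add: cone_support_expo)
  also have "\<dots> = lex_expos"
    by (auto simp: lex_expos_def lex_support_iff)
  finally have eq: "{g + u | g u. g \<in> support_expo ` lex_generators \<and> keys u \<subseteq> {1..11}} = lex_expos" .
  have keys: "keys g \<subseteq> {1..11}" if "g \<in> support_expo ` lex_generators" for g
    using that lex_generatorsD by (elim imageE) simp
  show ?thesis by (simp only: genideal_monomials[OF keys] eq)
qed

lemma lex_generators_image:
  "mono_poly ` support_expo ` lex_generators =
    ({xvar 1 * xvar j | j. j \<in> {2..11}} \<union> {xvar 2 * xvar 3, xvar 2 * xvar 4} :: 'k::field mpoly set)"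
proof -
  have "(mono_poly (support_expo {1, j}) :: 'k mpoly) = xvar 1 * xvar j" if "j \<in> {2..11}" for j
    using that by (intro mono_support_expo_pair) auto
  moreover have "(mono_poly (support_expo {2, 3}) :: 'k mpoly) = xvar 2 * xvar 3"
    "(mono_poly (support_expo {2, 4}) :: 'k mpoly) = xvar 2 * xvar 4"
    by (intro mono_support_expo_pair; simp)+
  ultimately show ?thesis by (simp only: lex_generators_def image_Un image_image Setcompr_eq_image image_insert image_empty cong: image_cong)
qed

text \<open>At the first index \<open>k\<close> where the exponents differ, $x_k$ divides the larger
  monomial and not the smaller. The position of \<open>k\<close> relative to 1, 2, 3, 4 decides
  everything.\<close>

lemma squarefree_lex_ideal_lex: "squarefree_lex_ideal 11 (supported lex_expos :: 'k::field mpoly set)"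
  unfolding squarefree_lex_ideal_def squarefree_monomial_ideal_def
proof (intro conjI allI impI)
  show "\<exists>G. (\<forall>t\<in>G. squarefree_expo 11 t) \<and>
      (supported lex_expos :: 'k mpoly set) = genideal (poly_ring 11) (mono_poly ` G)"
    by (rule exI[of _ "support_expo ` lex_generators"])
      (use lex_generatorsD in \<open>auto simp: genideal_lex squarefree_expo_def lookup_support_expo\<close>)
next
  fix u v
  assume a: "squarefree_expo 11 u \<and> squarefree_expo 11 v \<and> deg u = deg v \<and>
    mono_poly u \<in> (supported lex_expos :: 'k mpoly set) \<and> u < v"
  hence ku: "keys u \<subseteq> {1..11}" and kv: "keys v \<subseteq> {1..11}"
    and u1: "\<And>i. lookup u i \<le> 1" and v1: "\<And>i. lookup v i \<le> 1"
    and deg: "deg u = deg v" and u: "lex_support (keys u)"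
    by (auto simp: squarefree_expo_def lex_expos_def)
  from a obtain k where k: "lookup u k < lookup v k" "\<And>i. i < k \<Longrightarrow> lookup u i = lookup v i"
    by (auto simp: less_poly_mapping.rep_eq less_fun_def)
  have same: "i \<in> keys u \<longleftrightarrow> i \<in> keys v" if "i < k" for i
    using k(2)[OF that] by (simp add: in_keys_iff)
  have kk: "k \<in> keys v" "k \<notin> keys u"
    using k(1) u1[of k] v1[of k] by (auto simp: in_keys_iff)
  have card: "deg w = card (keys w)" if "\<And>i. lookup w i \<le> 1" for w
  proof -
    have "lookup w i = 1" if "i \<in> keys w" for i
      using \<open>\<And>i. lookup w i \<le> 1\<close>[of i] that by (auto simp: in_keys_iff)
    thus ?thesis by (simp add: deg_def)
  qed
  have "lex_support (keys v)"
  proof (cases "1 \<in> keys v")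
    case True
    \<comment> \<open>A squarefree multiple of $x_1$ is in the ideal once its degree is at least 2,
      and \<open>u\<close> has such a degree because it is divisible by a generator.\<close>
    obtain e where "e \<in> lex_generators" "e \<subseteq> keys u" using u by (auto simp: lex_support_iff)
    moreover from this have "card e = 2" by (auto simp: lex_generators_def)
    ultimately have "2 \<le> card (keys v)"
      using deg card[OF u1] card[OF v1] card_mono[of "keys u" e] by simp
    hence "\<not> keys v \<subseteq> {1}" using card_mono[of "{1}" "keys v"] by auto
    then obtain j where "j \<in> keys v" "j \<noteq> 1" by auto
    moreover from this have "j \<in> {2..11}" using kv by fastforce
    ultimately show ?thesis using True by (auto simp: lex_support_def)
  next
    case False
    hence "1 < k" using kk(1) kv by (cases k rule: linorder_cases[of 1]) auto
    hence "1 \<notin> keys u" using same[of 1] False by simp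
    hence u2: "2 \<in> keys u" "3 \<in> keys u \<or> 4 \<in> keys u" using u by (auto simp: lex_support_def)
    \<comment> \<open>Since $x_2$ divides \<open>u\<close>, the first difference comes after index
      2: it adds 3 or 4 to the support of \<open>v\<close>, or leaves both as they are in
      \<open>u\<close>.\<close>
    have "2 < k" using \<open>1 < k\<close> u2(1) kk(2) by (cases "k = 2") auto
    hence "2 \<in> keys v" using same u2 by blast
    moreover have "3 \<in> keys v \<or> 4 \<in> keys v"
    proof -
      consider "k = 3" | "k = 4" | "4 < k" using \<open>2 < k\<close> by linarith
      thus ?thesis using kk same[of 3] same[of 4] u2(2) by cases auto
    qed
    ultimately show ?thesis by (simp add: lex_support_def)
  qed
  thus "mono_poly v \<in> (supported lex_expos :: 'k mpoly set)"
    using kv by (simp add: lex_expos_def)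
qed

theorem mainTheorem10:
  fixes L :: "'k::field mpoly set"
  assumes "L = genideal (poly_ring 11) ({xvar 1 * xvar j | j. j \<in> {2..11}} \<union> {xvar 2 * xvar 3, xvar 2 * xvar 4})"
  shows "squarefree_lex_ideal 11 L \<and>
         sdepth 11 L = 6 \<and> sdepth 11 L < hdepth 11 L \<and> hdepth 11 L = 7"
proof -
  have "L = supported lex_expos"
    using assms by (simp only: genideal_lex flip: lex_generators_image)
  thus ?thesis
    by (simp add: squarefree_lex_ideal_lex sdepth_lex hdepth_lex)
qed

end
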